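(* Let $X$ be a compact metric space, $T:X\to X$ continuous with finite topological entropy $h_{top}(T)<\infty$, and $f:X\to\mathbb R$ continuous. If $Z\subseteq X$ is analytic, then \[ P_B(T,f,Z)=\sup\{P_B(T,f,K):\ K\subseteq Z,\ K \text{ compact}\}. \]
   Context: A subset of a metric space is analytic if it is a continuous image of $\mathcal N=\mathbb N^{\mathbb N}$ with the product topology. Notation: $d$ is the metric on $X$; $d_n(x,y)=\max\{d(T^ix,T^iy):0\le i\le n-1\}$, $B_n(x,\epsilon)=\{y:d_n(x,y)<\epsilon\}$, $f_n=\sum_{i=0}^{n-1}f\circ T^i$. Bowen topological pressure of $Z\subseteq X$: for $\epsilon>0$, $\Gamma=\{B_{n_i}(x_i,\epsilon)\}_i$ (finite or countable) is a cover of $Z$ if $Z\subseteq\bigcup_iB_{n_i}(x_i,\epsilon)$; $n(\Gamma)=\min_in_i$. For $s\in\mathbb R$, $N\in\mathbb N$, $M(Z,f,s,N,\epsilon)=\inf_\Gamma\sum_i\exp\big(-sn_i+\sup_{y\in B_{n_i}(x_i,\epsilon)}f_{n_i}(y)\big)$ over covers with $n(\Gamma)\ge N$; $m(Z,f,s,\epsilon)=\lim_{N\to\infty}M(Z,f,s,N,\epsilon)$; $P_B(T,f,Z,\epsilon)=\inf\{s:m(Z,f,s,\epsilon)=0\}=\sup\{s:m(Z,f,s,\epsilon)=+\infty\}$; $P_B(T,f,Z)=\lim_{\epsilon\to0}P_B(T,f,Z,\epsilon)$. *)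

theory Defs
  imports "HOL-Analysis.Analysis"
begin

text \<open>Dynamical distance d_n (with d_0 = 0 by convention).\<close>
definition dyn_dist :: "('a::metric_space \<Rightarrow> 'a) \<Rightarrow> nat \<Rightarrow> 'a \<Rightarrow> 'a \<Rightarrow> real" where
  "dyn_dist T n x y = Max (insert 0 {dist ((T ^^ i) x) ((T ^^ i) y) | i. i < n})"

definition bowen_ball ::
  "'a::metric_space set \<Rightarrow> ('a \<Rightarrow> 'a) \<Rightarrow> nat \<Rightarrow> 'a \<Rightarrow> real \<Rightarrow> 'a set" where
  "bowen_ball X T n x eps = {y \<in> X. dyn_dist T n x y < eps}"

definition birkhoff_sum :: "('a \<Rightarrow> 'a) \<Rightarrow> ('a \<Rightarrow> real) \<Rightarrow> nat \<Rightarrow> 'a \<Rightarrow> real" where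
  "birkhoff_sum T f n y = (\<Sum>i<n. f ((T ^^ i) y))"

definition bowen_cover ::
  "'a::metric_space set \<Rightarrow> ('a \<Rightarrow> 'a) \<Rightarrow> 'a set \<Rightarrow> nat \<Rightarrow> real \<Rightarrow> nat set \<Rightarrow> (nat \<Rightarrow> 'a) \<Rightarrow> (nat \<Rightarrow> nat) \<Rightarrow> bool" where
  "bowen_cover X T Z N eps I c k \<longleftrightarrow>
     (\<forall>i\<in>I. c i \<in> X \<and> N \<le> k i) \<and> Z \<subseteq> (\<Union>i\<in>I. bowen_ball X T (k i) (c i) eps)"

definition pressure_M ::
  "'a::metric_space set \<Rightarrow> ('a \<Rightarrow> 'a) \<Rightarrow> ('a \<Rightarrow> real) \<Rightarrow> 'a set \<Rightarrow> real \<Rightarrow> nat \<Rightarrow> real \<Rightarrow> ennreal" where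
  "pressure_M X T f Z s N eps = Inf {(\<Sum>i. if i \<in> I then
        ennreal (exp (- s * real (k i) + Sup (birkhoff_sum T f (k i) ` bowen_ball X T (k i) (c i) eps)))
        else 0) | I c k. bowen_cover X T Z N eps I c k}"

text \<open>m(Z,f,s,eps) = lim_{N\<to>\<infinity>} M(Z,f,s,N,eps); M is nondecreasing in N, so the limit is the SUP.\<close>
definition pressure_m ::
  "'a::metric_space set \<Rightarrow> ('a \<Rightarrow> 'a) \<Rightarrow> ('a \<Rightarrow> real) \<Rightarrow> 'a set \<Rightarrow> real \<Rightarrow> real \<Rightarrow> ennreal" where
  "pressure_m X T f Z s eps = (SUP N. pressure_M X T f Z s N eps)"

definition bowen_pressure_eps ::
  "'a::metric_space set \<Rightarrow> ('a \<Rightarrow> 'a) \<Rightarrow> ('a \<Rightarrow> real) \<Rightarrow> 'a set \<Rightarrow> real \<Rightarrow> ereal" where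
  "bowen_pressure_eps X T f Z eps = Inf (ereal ` {s. pressure_m X T f Z s eps = 0})"

definition bowen_pressure ::
  "'a::metric_space set \<Rightarrow> ('a \<Rightarrow> 'a) \<Rightarrow> ('a \<Rightarrow> real) \<Rightarrow> 'a set \<Rightarrow> ereal" where
  "bowen_pressure X T f Z = Lim (at_right 0) (\<lambda>eps. bowen_pressure_eps X T f Z eps)"

definition separated_set :: "'a::metric_space set \<Rightarrow> ('a \<Rightarrow> 'a) \<Rightarrow> nat \<Rightarrow> real \<Rightarrow> 'a set \<Rightarrow> bool" where
  "separated_set X T n eps E \<longleftrightarrow> E \<subseteq> X \<and> (\<forall>x\<in>E. \<forall>y\<in>E. x \<noteq> y \<longrightarrow> dyn_dist T n x y > eps)"

definition max_separated :: "'a::metric_space set \<Rightarrow> ('a \<Rightarrow> 'a) \<Rightarrow> nat \<Rightarrow> real \<Rightarrow> nat" where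
  "max_separated X T n eps = Sup {card E | E. finite E \<and> separated_set X T n eps E}"

definition top_entropy :: "'a::metric_space set \<Rightarrow> ('a \<Rightarrow> 'a) \<Rightarrow> ereal" where
  "top_entropy X T = Lim (at_right 0)
     (\<lambda>eps. limsup (\<lambda>n. ereal (ln (real (max_separated X T n eps)) / real n)))"

definition analytic_set :: "'a::topological_space set \<Rightarrow> bool" where
  "analytic_set Z \<longleftrightarrow> (\<exists>g :: (nat \<Rightarrow> nat) \<Rightarrow> 'a. continuous_on UNIV g \<and> g ` UNIV = Z)"

end

theory Submission
  imports Defs
begin

text \<open>
  The content of a set is made a Choquet capacity by replacing Bowen balls by the cells of a tree.
  Restrict to levels \<open>\<nu>\<^sub>0 < \<nu>\<^sub>1 < \<dots>\<close> that grow geometrically with ratio close to \<open>1\<close>. On each of them a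
  sparse cover of the metric space \<open>(X, d\<^sub>n)\<close>, \<open>n = \<nu>\<^sub>k\<close>, obtained by growing balls until they stop
  expanding by a factor \<open>e\<^bsup>\<eta>n\<^esup>\<close>, yields a partition into sets of \<open>d\<^sub>n\<close>-diameter less than \<open>\<Delta>\<close> of which
  every \<open>(n, r)\<close>-Bowen ball meets at most \<open>e\<^bsup>\<tau>n\<^esup>\<close>, where \<open>r\<close> is a small multiple of \<open>\<Delta>\<close>; as the
  \<open>(n, r)\<close>-entropy is bounded independently of \<open>r\<close>, \<open>\<tau>\<close> can be made arbitrarily small. Since the levels
  are geometric, a Bowen ball still meets only \<open>e\<^bsup>\<gamma>n\<^esup>\<close> cells of the common refinement of the first \<open>k\<close>
  partitions. So the content built from these nested cells lies between Caratheodory sums at the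
  scales \<open>\<Delta>\<close> and \<open>r\<close> whose exponents differ by \<open>O(\<gamma>)\<close>. For nested cells the content is continuous
  along increasing sequences of sets, so an analytic set of positive content contains sets
  \<open>g({\<sigma>. \<sigma>\<^sub>j \<le> b\<^sub>j for j < i})\<close> whose contents are bounded below uniformly in \<open>i\<close>; any cover by open
  Bowen balls of the compact set \<open>g({\<sigma>. \<sigma>\<^sub>j \<le> b\<^sub>j for all j})\<close> already covers one of them.
\<close>

section \<open>Content of a laminar family\<close>

text \<open>The first component is a depth, kept apart from the set because one set can occur at
  several depths with different weights. At equal depth the condition applies both ways, so the sets
  are equal or disjoint.\<close>

definition laminar :: "(nat \<times> 'a set) set \<Rightarrow> bool" where
  "laminar \<N> \<longleftrightarrow> (\<forall>a\<in>\<N>. \<forall>b\<in>\<N>. fst a \<le> fst b \<longrightarrow> snd a \<inter> snd b = {} \<or> snd b \<subseteq> snd a)"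

lemma laminarD:
  assumes "laminar \<N>" "a \<in> \<N>" "b \<in> \<N>" "fst a \<le> fst b" "x \<in> snd a" "x \<in> snd b"
  shows "snd b \<subseteq> snd a"
  using assms unfolding laminar_def by blast

text \<open>Total weights are values of a measure, so additivity and continuity from below apply to
  families of nodes without enumerating them.\<close>

definition node_cost :: "(nat \<times> 'a set \<Rightarrow> ennreal) \<Rightarrow> (nat \<times> 'a set) measure" where
  "node_cost w = density (count_space UNIV) w"

definition node_content ::
  "(nat \<times> 'a set) set \<Rightarrow> (nat \<times> 'a set \<Rightarrow> ennreal) \<Rightarrow> 'a set \<Rightarrow> ennreal" where
  "node_content \<N> w A = Inf {emeasure (node_cost w) I | I. I \<subseteq> \<N> \<and> A \<subseteq> \<Union>(snd ` I)}"

definition top_nodes :: "(nat \<times> 'a set) set \<Rightarrow> (nat \<times> 'a set) set" where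
  "top_nodes I = {a \<in> I. \<forall>b\<in>I. fst b < fst a \<longrightarrow> snd a \<inter> snd b = {}}"

lemma sets_node_cost [simp]: "sets (node_cost w) = UNIV"
  by (simp add: node_cost_def)

lemma node_content_le:
  "I \<subseteq> \<N> \<Longrightarrow> A \<subseteq> \<Union>(snd ` I) \<Longrightarrow> node_content \<N> w A \<le> emeasure (node_cost w) I"
  unfolding node_content_def by (rule Inf_lower) auto

lemma node_content_mono: "A \<subseteq> B \<Longrightarrow> node_content \<N> w A \<le> node_content \<N> w B"
  unfolding node_content_def by (rule Inf_superset_mono) blast

lemma top_nodes_subset: "top_nodes I \<subseteq> I"
  by (auto simp: top_nodes_def)

text \<open>Among the members containing a point take one of least depth: a shallower member meeting
  it would contain it, hence the point, against minimality.\<close>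

lemma Union_top_nodes:
  assumes "laminar \<N>" "I \<subseteq> \<N>"
  shows "\<Union>(snd ` top_nodes I) = \<Union>(snd ` I)"
proof
  show "\<Union>(snd ` top_nodes I) \<subseteq> \<Union>(snd ` I)"
    by (auto simp: top_nodes_def)
  show "\<Union>(snd ` I) \<subseteq> \<Union>(snd ` top_nodes I)"
  proof
    fix x assume "x \<in> \<Union>(snd ` I)"
    then obtain a where a: "a \<in> I \<and> x \<in> snd a"
      and least: "\<And>b. b \<in> I \<and> x \<in> snd b \<Longrightarrow> fst a \<le> fst b"
      using ex_has_least_nat[of "\<lambda>a. a \<in> I \<and> x \<in> snd a" _ fst] by (metis UN_E)
    have "a \<in> top_nodes I"
      unfolding top_nodes_def
    proof (safe, goal_cases)
      case 1
      then show ?case using a by simp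
    next
      case (2 l R y)
      then have "snd a \<subseteq> R"
        using laminarD[OF assms(1), of "(l, R)" a y] assms(2) a by auto
      then show ?case
        using 2 a least[of "(l, R)"] by auto
    qed
    with a show "x \<in> \<Union>(snd ` top_nodes I)" by blast
  qed
qed

text \<open>A strong subadditivity: the nodes discarded from the two families still cover the intersection
  of their unions, because two nodes containing the same point are nested.\<close>
lemma top_nodes_Un_cost:
  assumes lam: "laminar \<N>" and A: "A \<subseteq> \<N>" and B: "B \<subseteq> \<N>"
    and E: "E \<subseteq> \<Union>(snd ` A)" "E \<subseteq> \<Union>(snd ` B)"
  shows "emeasure (node_cost w) (top_nodes (A \<union> B)) + node_content \<N> w E
    \<le> emeasure (node_cost w) (top_nodes A) + emeasure (node_cost w) B"
proof -
  let ?\<mu> = "emeasure (node_cost w)"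
  define J where "J = top_nodes A"
  define K where "K = top_nodes (A \<union> B)"
  have J: "J \<subseteq> A" and K: "K \<subseteq> J \<union> B"
    by (auto simp: J_def K_def top_nodes_def)
  \<comment> \<open>Over a point of \<open>E\<close> lie a node of \<open>J\<close> and one of
    \<open>B\<close>. If the depths differ, the deeper node is not in \<open>K\<close>; if they
    agree, the nodes coincide and lie in \<open>J \<inter> B\<close>.\<close>
  have "E \<subseteq> \<Union>(snd ` (((J \<union> B) - K) \<union> (J \<inter> B)))"
  proof
    fix x assume "x \<in> E"
    then obtain a b where a: "a \<in> J" "x \<in> snd a" and b: "b \<in> B" "x \<in> snd b"
      using E Union_top_nodes[OF lam A] unfolding J_def by blast
    have AB: "a \<in> A \<union> B" "b \<in> A \<union> B" "a \<in> \<N>" "b \<in> \<N>"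
      using a b J A B by auto
    consider "fst a < fst b" | "fst b < fst a" | "fst a = fst b" by linarith
    then show "x \<in> \<Union>(snd ` (((J \<union> B) - K) \<union> (J \<inter> B)))"
    proof cases
      case 1
      then have "b \<notin> K" using a b AB by (auto simp: K_def top_nodes_def)
      then show ?thesis using b by blast
    next
      case 2
      then have "a \<notin> K" using a b AB by (auto simp: K_def top_nodes_def)
      then show ?thesis using a by blast
    next
      case 3
      then have "a = b"
        using laminarD[OF lam, of a b x] laminarD[OF lam, of b a x] AB a b
        by (simp add: prod_eq_iff)
      then show ?thesis using a b by blast
    qed
  qed
  then have "node_content \<N> w E \<le> ?\<mu> (((J \<union> B) - K) \<union> (J \<inter> B))"
    using J A B by (intro node_content_le) auto
  also have "\<dots> \<le> ?\<mu> ((J \<union> B) - K) + ?\<mu> (J \<inter> B)"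
    by (intro emeasure_subadditive) auto
  finally have "?\<mu> K + node_content \<N> w E \<le> (?\<mu> K + ?\<mu> ((J \<union> B) - K)) + ?\<mu> (J \<inter> B)"
    by (simp add: add.assoc add_left_mono)
  also have "?\<mu> K + ?\<mu> ((J \<union> B) - K) = ?\<mu> (K \<union> ((J \<union> B) - K))"
    by (intro plus_emeasure) auto
  also have "K \<union> ((J \<union> B) - K) = J \<union> B" using K by auto
  also have "?\<mu> (J \<union> B) + ?\<mu> (J \<inter> B) = ?\<mu> J + ?\<mu> B"
    by (intro emeasure_Un_Int[symmetric]) auto
  finally show ?thesis unfolding J_def K_def .
qed

lemma node_content_approx:
  assumes "node_content \<N> w A < top" "0 < (e::ennreal)"
  obtains I where "I \<subseteq> \<N>" "A \<subseteq> \<Union>(snd ` I)"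
    "emeasure (node_cost w) I \<le> node_content \<N> w A + e"
proof -
  have "node_content \<N> w A < node_content \<N> w A + e"
    using assms ennreal_add_left_cancel_less[of "node_content \<N> w A" 0 e] by simp
  then have "Inf {emeasure (node_cost w) I | I. I \<subseteq> \<N> \<and> A \<subseteq> \<Union>(snd ` I)} < node_content \<N> w A + e"
    by (simp only: node_content_def)
  then obtain I where "I \<subseteq> \<N>" "A \<subseteq> \<Union>(snd ` I)"
    "emeasure (node_cost w) I < node_content \<N> w A + e"
    unfolding Inf_less_iff by blast
  with that show ?thesis by (meson less_imp_le)
qed

text \<open>Induction by \<open>top_nodes_Un_cost\<close> with \<open>E = A n\<close>: merging the
  next family saves at least the content of \<open>A n\<close>, which is finite and cancels. So the
  errors accumulate, but not the costs.\<close>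

lemma top_nodes_cost_le:
  assumes lam: "laminar \<N>" and inc: "incseq A" and fin: "\<And>n. node_content \<N> w (A n) < top"
    and I: "\<And>n. I n \<subseteq> \<N>" "\<And>n. A n \<subseteq> \<Union>(snd ` I n)"
      "\<And>n. emeasure (node_cost w) (I n) \<le> node_content \<N> w (A n) + \<epsilon> n"
  shows "emeasure (node_cost w) (top_nodes (\<Union>i\<le>n. I i)) \<le> node_content \<N> w (A n) + (\<Sum>i\<le>n. \<epsilon> i)"
proof (induction n)
  case 0
  have "emeasure (node_cost w) (top_nodes (\<Union>i\<le>0. I i)) \<le> emeasure (node_cost w) (I 0)"
    by (intro emeasure_mono) (auto simp: top_nodes_def)
  also note I(3)[of 0]
  finally show ?case by simp
next
  case (Suc n)
  let ?\<mu> = "emeasure (node_cost w)" and ?c = "node_content \<N> w"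
  have "?\<mu> (top_nodes ((\<Union>i\<le>n. I i) \<union> I (Suc n))) + ?c (A n)
      \<le> ?\<mu> (top_nodes (\<Union>i\<le>n. I i)) + ?\<mu> (I (Suc n))"
  proof (rule top_nodes_Un_cost[OF lam])
    show "(\<Union>i\<le>n. I i) \<subseteq> \<N>" using I(1) by blast
    show "A n \<subseteq> \<Union>(snd ` (\<Union>i\<le>n. I i))" using I(2)[of n] by blast
    show "A n \<subseteq> \<Union>(snd ` I (Suc n))"
      by (rule order_trans[OF incseq_SucD[OF inc] I(2)])
  qed (rule I(1))
  also have "(\<Union>i\<le>n. I i) \<union> I (Suc n) = (\<Union>i\<le>Suc n. I i)"
    by (auto simp: atMost_Suc)
  finally have "?c (A n) + ?\<mu> (top_nodes (\<Union>i\<le>Suc n. I i))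
      \<le> ?\<mu> (top_nodes (\<Union>i\<le>n. I i)) + ?\<mu> (I (Suc n))"
    by (simp only: add.commute)
  also have "\<dots> \<le> (?c (A n) + (\<Sum>i\<le>n. \<epsilon> i)) + (?c (A (Suc n)) + \<epsilon> (Suc n))"
    by (intro add_mono Suc.IH I)
  also have "\<dots> = ?c (A n) + (?c (A (Suc n)) + (\<Sum>i\<le>Suc n. \<epsilon> i))"
    by (simp add: ac_simps)
  finally show ?case
    using fin[of n] unfolding ennreal_add_left_cancel_le by auto
qed

text \<open>This is what a Choquet capacity needs along increasing sequences. Near-optimal covers of
  all the \<open>A n\<close> are merged through their top nodes, and the result costs at most the
  supremum plus the sum of the errors.\<close>

lemma node_content_UN_incseq:
  assumes lam: "laminar \<N>" and inc: "incseq A"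
  shows "node_content \<N> w (\<Union>n. A n) = (SUP n. node_content \<N> w (A n))"
proof (rule antisym)
  let ?\<mu> = "emeasure (node_cost w)" and ?c = "node_content \<N> w"
  show "(SUP n. ?c (A n)) \<le> ?c (\<Union>n. A n)"
    by (intro SUP_least node_content_mono) auto
  show "?c (\<Union>n. A n) \<le> (SUP n. ?c (A n))"
  proof (rule ennreal_le_epsilon)
    fix e :: real assume fin: "(SUP n. ?c (A n)) < top" and e: "0 < e"
    have cfin: "?c (A n) < top" for n
      by (rule le_less_trans[OF SUP_upper fin]) simp
    define \<epsilon> where "\<epsilon> n = ennreal (e * (1/2) ^ Suc n)" for n
    have epos: "0 < \<epsilon> n" for n
      unfolding \<epsilon>_def using e by simp
    have "\<exists>I. I \<subseteq> \<N> \<and> A n \<subseteq> \<Union>(snd ` I) \<and> ?\<mu> I \<le> ?c (A n) + \<epsilon> n" for n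
      by (rule node_content_approx[OF cfin[of n] epos[of n]]) blast
    then obtain I where I: "\<And>n. I n \<subseteq> \<N>" "\<And>n. A n \<subseteq> \<Union>(snd ` I n)"
      "\<And>n. ?\<mu> (I n) \<le> ?c (A n) + \<epsilon> n"
      by metis
    have esum: "(\<Sum>i\<le>n. \<epsilon> i) \<le> ennreal e" for n
    proof -
      have "(\<Sum>i\<le>n. e * (1/2) ^ Suc i) = e - e * (1/2) ^ Suc n"
        by (induction n) (auto simp: field_simps)
      then show ?thesis
        unfolding \<epsilon>_def using e by (subst sum_ennreal) (auto intro!: ennreal_leI)
    qed
    define L where "L = top_nodes (\<Union>i. I i)"
    have "L \<subseteq> (\<Union>i. I i)" unfolding L_def by (rule top_nodes_subset)
    then have L_eq: "L = (\<Union>n. L \<inter> (\<Union>i\<le>n. I i))" by blast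
    have "?c (\<Union>n. A n) \<le> ?\<mu> L"
    proof (rule node_content_le)
      show "L \<subseteq> \<N>" using I(1) unfolding L_def top_nodes_def by blast
      have "\<Union>(snd ` L) = \<Union>(snd ` (\<Union>i. I i))"
        unfolding L_def using I(1) by (intro Union_top_nodes[OF lam]) blast
      moreover have "A n \<subseteq> \<Union>(snd ` (\<Union>i. I i))" for n
        by (rule order_trans[OF I(2)[of n]]) auto
      ultimately show "(\<Union>n. A n) \<subseteq> \<Union>(snd ` L)" by (metis UN_least)
    qed
    also have "?\<mu> L = ?\<mu> (\<Union>n. L \<inter> (\<Union>i\<le>n. I i))"
      by (rule arg_cong[OF L_eq])
    also have "\<dots> = (SUP n. ?\<mu> (L \<inter> (\<Union>i\<le>n. I i)))"
      by (intro SUP_emeasure_incseq[symmetric] incseq_SucI) (auto simp: atMost_Suc)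
    also have "\<dots> \<le> (SUP n. ?c (A n)) + ennreal e"
    proof (rule SUP_least)
      fix n
      \<comment> \<open>A node that is top in the whole union is top in every subfamily containing
        it.\<close>
      have "?\<mu> (L \<inter> (\<Union>i\<le>n. I i)) \<le> ?\<mu> (top_nodes (\<Union>i\<le>n. I i))"
        by (intro emeasure_mono) (auto simp: L_def top_nodes_def)
      also have "\<dots> \<le> ?c (A n) + (\<Sum>i\<le>n. \<epsilon> i)"
        by (rule top_nodes_cost_le[OF lam inc cfin I])
      also have "\<dots> \<le> (SUP n. ?c (A n)) + ennreal e"
        by (intro add_mono esum SUP_upper) auto
      finally show "?\<mu> (L \<inter> (\<Union>i\<le>n. I i)) \<le> (SUP n. ?c (A n)) + ennreal e" .
    qed
    finally show "?c (\<Union>n. A n) \<le> (SUP n. ?c (A n)) + ennreal e" .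
  qed
qed

section \<open>Continuous images of Baire space\<close>

text \<open>Only finitely many coordinates are bounded: these sets decrease to a compact box as
  \<open>i\<close> grows, but are not compact themselves.\<close>

definition cylinder_below :: "(nat \<Rightarrow> nat) \<Rightarrow> nat \<Rightarrow> (nat \<Rightarrow> nat) set" where
  "cylinder_below b i = {\<sigma>. \<forall>j<i. \<sigma> j \<le> b j}"

text \<open>The bounds are chosen one coordinate at a time. As the bound \<open>m\<close> on the
  next coordinate grows, the images increase to the current one, so continuity of \<open>c\<close>
  keeps one of them above \<open>a\<close>.\<close>

lemma exists_bounding_sequence:
  fixes c :: "'a set \<Rightarrow> ennreal" and g :: "(nat \<Rightarrow> nat) \<Rightarrow> 'a"
  assumes cont: "\<And>A. incseq A \<Longrightarrow> c (\<Union>n. A n) = (SUP n. c (A n))"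
    and a: "a < c (range g)"
  shows "\<exists>b. \<forall>i. a < c (g ` cylinder_below b i)"
proof -
  have "\<exists>f. \<forall>n. a < c (g ` cylinder_below (f n) n) \<and> (\<forall>j<n. f (Suc n) j = f n j)"
  proof (rule dependent_nat_choice)
    show "\<exists>b. a < c (g ` cylinder_below b 0)"
      using a by (simp add: cylinder_below_def)
  next
    fix b n assume "a < c (g ` cylinder_below b n)"
    moreover have "g ` cylinder_below b n = (\<Union>m. g ` cylinder_below (b(n := m)) (Suc n))"
    proof -
      have "cylinder_below b n = (\<Union>m. cylinder_below (b(n := m)) (Suc n))"
        by (auto simp: cylinder_below_def less_Suc_eq)
      then show ?thesis by auto
    qed
    moreover have "incseq (\<lambda>m. g ` cylinder_below (b(n := m)) (Suc n))"
      by (intro incseq_SucI image_mono) (auto simp: cylinder_below_def less_Suc_eq)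
    ultimately obtain m where "a < c (g ` cylinder_below (b(n := m)) (Suc n))"
      using cont by (metis (no_types, lifting) less_SUP_iff)
    then show "\<exists>b'. a < c (g ` cylinder_below b' (Suc n)) \<and> (\<forall>j<n. b' j = b j)"
      by (intro exI[of _ "b(n := m)"]) auto
  qed
  then obtain f where f: "\<And>n. a < c (g ` cylinder_below (f n) n)"
    and step: "\<And>n j. j < n \<Longrightarrow> f (Suc n) j = f n j" by metis
  \<comment> \<open>Later choices leave earlier coordinates alone, so the diagonal sequence has the
    same cylinders as the finite stages.\<close>
  have stable: "f n j = f (Suc j) j" if "j < n" for n j
    using that by (induction n) (auto simp: less_Suc_eq step)
  have "cylinder_below (\<lambda>j. f (Suc j) j) n = cylinder_below (f n) n" for n
  proof -
    have "\<sigma> j \<le> f (Suc j) j \<longleftrightarrow> \<sigma> j \<le> f n j" if "j < n" for \<sigma> j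
      by (subst stable[OF that]) (rule refl)
    then show ?thesis unfolding cylinder_below_def by blast
  qed
  then have "a < c (g ` cylinder_below (\<lambda>j. f (Suc j) j) n)" for n
    using f[of n] by simp
  then show ?thesis by (intro exI allI)
qed

lemma compact_box_below: "compact {\<sigma> :: nat \<Rightarrow> nat. \<forall>j. \<sigma> j \<le> b j}"
proof -
  have "compactin (product_topology (\<lambda>_. euclidean) UNIV) (\<Pi>\<^sub>E j\<in>UNIV. {..b j})"
    unfolding compactin_PiE by (auto intro: finite_imp_compact)
  moreover have "(\<Pi>\<^sub>E j\<in>UNIV. {..b j}) = {\<sigma>. \<forall>j. \<sigma> j \<le> b j}"
    by (auto simp: PiE_def)
  ultimately show ?thesis
    by (simp add: euclidean_product_topology)
qed

lemma tendsto_fun_iff: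
  fixes f :: "'b \<Rightarrow> 'c \<Rightarrow> 'a::topological_space"
  shows "(f \<longlongrightarrow> l) F \<longleftrightarrow> (\<forall>i. ((\<lambda>x. f x i) \<longlongrightarrow> l i) F)"
  using limitin_componentwise[of "\<lambda>_. euclidean" UNIV f l F]
  by (simp add: euclidean_product_topology limitin_canonical_iff)

text \<open>Suppose every cylinder has a point \<open>\<tau> i\<close> mapped outside
  \<open>U\<close>. Truncation at \<open>b\<close> moves these points into the compact box and
  leaves coordinate \<open>j\<close> unchanged once \<open>i > j\<close>. Hence a convergent
  subsequence of the truncations has the same limit as the corresponding \<open>\<tau> i\<close>;
  this limit lies in the box and is mapped into the open set \<open>U\<close>.\<close>

lemma open_contains_cylinder_below:
  fixes g :: "(nat \<Rightarrow> nat) \<Rightarrow> 'a::topological_space"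
  assumes cont: "continuous_on UNIV g" and "open U"
    and sub: "g ` {\<sigma>. \<forall>j. \<sigma> j \<le> b j} \<subseteq> U"
  shows "\<exists>i. g ` cylinder_below b i \<subseteq> U"
proof (rule ccontr)
  assume "\<nexists>i. g ` cylinder_below b i \<subseteq> U"
  then have "\<forall>i. \<exists>\<tau>. \<tau> \<in> cylinder_below b i \<and> g \<tau> \<notin> U" by blast
  then obtain \<tau> where \<tau>: "\<And>i. \<tau> i \<in> cylinder_below b i" "\<And>i. g (\<tau> i) \<notin> U" by metis
  have "seq_compact {\<sigma> :: nat \<Rightarrow> nat. \<forall>j. \<sigma> j \<le> b j}"
    using compact_box_below compact_imp_seq_compact by blast
  then obtain \<sigma> r where \<sigma>: "\<forall>j. \<sigma> j \<le> b j" and r: "strict_mono (r :: nat \<Rightarrow> nat)"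
    and lim: "((\<lambda>i j. min (\<tau> i j) (b j)) \<circ> r) \<longlonglongrightarrow> \<sigma>"
    by (elim seq_compactE[where f = "\<lambda>i j. min (\<tau> i j) (b j)"]) auto
  have "(\<lambda>i. \<tau> (r i)) \<longlonglongrightarrow> \<sigma>"
    unfolding tendsto_fun_iff
  proof
    fix j
    have "(\<lambda>i. min (\<tau> (r i) j) (b j)) \<longlonglongrightarrow> \<sigma> j"
      using lim by (simp add: tendsto_fun_iff o_def)
    moreover have "\<forall>\<^sub>F i in sequentially. min (\<tau> (r i) j) (b j) = \<tau> (r i) j"
      using eventually_gt_at_top[of j]
    proof eventually_elim
      case (elim i)
      then have "j < r i" using seq_suble[OF r, of i] by linarith
      then show ?case using \<tau>(1)[of "r i"] by (auto simp: cylinder_below_def)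
    qed
    ultimately show "(\<lambda>i. \<tau> (r i) j) \<longlonglongrightarrow> \<sigma> j"
      by (rule Lim_transform_eventually)
  qed
  then have "(\<lambda>i. g (\<tau> (r i))) \<longlonglongrightarrow> g \<sigma>"
    by (rule continuous_on_tendsto_compose[OF cont]) auto
  moreover have "g \<sigma> \<in> U" using sub \<sigma> by blast
  ultimately have "\<forall>\<^sub>F i in sequentially. g (\<tau> (r i)) \<in> U"
    using \<open>open U\<close> by (auto dest: topological_tendstoD)
  then show False using \<tau>(2) by auto
qed

section \<open>Sparse colourings of finite metric spaces\<close>

text \<open>Otherwise \<open>b\<close> grows by more than the factor \<open>l\<close> in each of
  \<open>k\<close> steps, starting from at least 1, and overshoots the cap
  \<open>l ^ k\<close>.\<close>

lemma exists_slow_growth: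
  fixes b :: "nat \<Rightarrow> nat" and l :: real
  assumes "1 \<le> b 0" and "real (b k) \<le> l ^ k" and "0 < k" and "1 \<le> l"
  shows "\<exists>j<k. real (b (Suc j)) \<le> l * real (b j)"
proof (rule ccontr)
  assume "\<not> ?thesis"
  then have step: "l * real (b j) < real (b (Suc j))" if "j < k" for j
    using that by auto
  have "l ^ j \<le> real (b j) \<and> (0 < j \<longrightarrow> l ^ j < real (b j))" if "j \<le> k" for j
    using that
  proof (induction j)
    case 0
    then show ?case using assms by simp
  next
    case (Suc j)
    then have "l ^ Suc j \<le> l * real (b j)" using assms(4) by (auto intro: mult_left_mono)
    then show ?case using step[of j] Suc.prems by auto
  qed
  from this[of k] assms show False by auto
qed

text \<open>Grow a ball around a point in steps of \<open>\<rho>\<close> until a step enlarges it by a factor at most \<open>l\<close>,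
  make it a cluster, discard its last shell, and repeat in the remaining set.\<close>
lemma separated_clusters:
  fixes D :: "'a \<Rightarrow> 'a \<Rightarrow> real" and l \<rho> :: real
  assumes D0: "\<And>x. D x x = 0" and Dtri: "\<And>x y z. D x z \<le> D x y + D y z"
    and Dsym: "\<And>x y. D x y = D y x"
    and "finite U" and "real (card U) \<le> l ^ k" and "0 < k" and "1 \<le> l" and "0 \<le> \<rho>"
  shows "\<exists>V lab. V \<subseteq> U \<and> real (card U) \<le> l * real (card V) \<and>
    (\<forall>x\<in>V. D x (lab x) \<le> real k * \<rho>) \<and>
    (\<forall>x\<in>V. \<forall>y\<in>V. D x y \<le> \<rho> \<longrightarrow> lab x = lab y)"
  using assms(4,5)
proof (induction U rule: finite_psubset_induct)
  case (psubset U)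
  show ?case
  proof (cases "U = {}")
    case True
    then show ?thesis by auto
  next
    case False
    then obtain u where u: "u \<in> U" by auto
    define b where "b j = {y\<in>U. D u y \<le> real j * \<rho>}" for j :: nat
    have finb: "finite (b j)" for j using psubset.hyps by (simp add: b_def)
    have "\<exists>j<k. real (card (b (Suc j))) \<le> l * real (card (b j))"
    proof (rule exists_slow_growth)
      have "u \<in> b 0" using u D0 by (simp add: b_def)
      then show "1 \<le> card (b 0)" using finb[of 0] by (metis One_nat_def Suc_leI card_gt_0_iff empty_iff)
      have "card (b k) \<le> card U" using psubset.hyps by (intro card_mono) (auto simp: b_def)
      then show "real (card (b k)) \<le> l ^ k" using psubset.prems by linarith
    qed (use assms in auto)
    then obtain j where j: "j < k" "real (card (b (Suc j))) \<le> l * real (card (b j))" by blast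
    define U' where "U' = U - b (Suc j)"
    have bmono: "b j \<subseteq> b (Suc j)"
      using \<open>0 \<le> \<rho>\<close> by (auto simp: b_def distrib_right)
    have ub: "u \<in> b j" using u D0 \<open>0 \<le> \<rho>\<close> by (simp add: b_def)
    then have "U' \<subset> U" using u bmono by (auto simp: U'_def)
    moreover have "real (card U') \<le> l ^ k"
      using psubset.prems card_mono[of U U'] psubset.hyps by (auto simp: U'_def)
    ultimately obtain V lab where V: "V \<subseteq> U'" "real (card U') \<le> l * real (card V)"
      "\<And>x. x \<in> V \<Longrightarrow> D x (lab x) \<le> real k * \<rho>"
      "\<And>x y. x \<in> V \<Longrightarrow> y \<in> V \<Longrightarrow> D x y \<le> \<rho> \<Longrightarrow> lab x = lab y"
      using psubset.IH[of U'] by blast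
    define lab' where "lab' x = (if x \<in> b j then u else lab x)" for x
    have disj: "V \<inter> b (Suc j) = {}" using V(1) by (auto simp: U'_def)
    have finV: "finite V" using V(1) psubset.hyps by (auto simp: U'_def intro: finite_subset)
    \<comment> \<open>A later point within \<open>\<rho>\<close> of the cluster would belong to
      \<open>b (Suc j)\<close>, which has been removed; the discarded shell is the moat between
      clusters.\<close>
    have far: "\<not> D x y \<le> \<rho>" if "x \<in> b j" "y \<in> V" for x y
    proof
      assume "D x y \<le> \<rho>"
      then have "D u y \<le> real (Suc j) * \<rho>"
        using Dtri[of u y x] that by (auto simp: b_def algebra_simps)
      then show False using that disj V(1) by (auto simp: b_def U'_def)
    qed
    show ?thesis
    proof (intro exI[of _ "b j \<union> V"] exI[of _ lab'] conjI ballI impI)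
      show "b j \<union> V \<subseteq> U" using V(1) by (auto simp: b_def U'_def)
      have "card U = card (b (Suc j)) + card U'"
      proof -
        have "b (Suc j) \<subseteq> U" by (auto simp: b_def)
        then show ?thesis
          using card_Diff_subset[OF finb] card_mono[OF psubset.hyps(1)] by (simp add: U'_def)
      qed
      also have "card (b j \<union> V) = card (b j) + card V"
        using disj bmono finb finV by (intro card_Un_disjoint) auto
      ultimately show "real (card U) \<le> l * real (card (b j \<union> V))"
        using j(2) V(2) by (auto simp: algebra_simps)
    next
      fix x assume x: "x \<in> b j \<union> V"
      have "real j * \<rho> \<le> real k * \<rho>" using j(1) \<open>0 \<le> \<rho>\<close> by (intro mult_right_mono) auto
      then show "D x (lab' x) \<le> real k * \<rho>"
        using x V(3) Dsym[of x u] by (auto simp: lab'_def b_def)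
    next
      fix x y assume xy: "x \<in> b j \<union> V" "y \<in> b j \<union> V" "D x y \<le> \<rho>"
      then show "lab' x = lab' y"
        using far[of x y] far[of y x] V(4)[of x y] Dsym[of x y] by (auto simp: lab'_def)
    qed
  qed
qed

text \<open>Each round applies \<open>separated_clusters\<close> to the uncoloured points and gives
  those it captures a fresh colour. It captures at least the fraction \<open>1 / l\<close> of
  them.\<close>

lemma separated_colouring_steps:
  fixes D :: "'a \<Rightarrow> 'a \<Rightarrow> real" and l \<rho> :: real
  assumes D0: "\<And>x. D x x = 0" and Dtri: "\<And>x y z. D x z \<le> D x y + D y z"
    and Dsym: "\<And>x y. D x y = D y x"
    and "finite U" and "real (card U) \<le> l ^ k" and "0 < k" and "1 \<le> l" and "0 \<le> \<rho>"
  shows "\<exists>W col lab. W \<subseteq> U \<and> real (card (U - W)) \<le> (1 - 1 / l) ^ m * real (card U) \<and>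
    (\<forall>x\<in>W. col x < m \<and> D x (lab x) \<le> real k * \<rho>) \<and>
    (\<forall>x\<in>W. \<forall>y\<in>W. col x = (col y :: nat) \<longrightarrow> D x y \<le> \<rho> \<longrightarrow> lab x = lab y)"
proof (induction m)
  case 0
  show ?case by (intro exI[of _ "{}"]) auto
next
  case (Suc m)
  then obtain W col lab where W: "W \<subseteq> U" "real (card (U - W)) \<le> (1 - 1 / l) ^ m * real (card U)"
    "\<And>x. x \<in> W \<Longrightarrow> col x < m \<and> D x (lab x) \<le> real k * \<rho>"
    "\<And>x y. x \<in> W \<Longrightarrow> y \<in> W \<Longrightarrow> col x = (col y :: nat) \<Longrightarrow> D x y \<le> \<rho> \<Longrightarrow> lab x = lab y"
    by blast
  have finW: "finite (U - W)" using assms(4) by simp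
  have cardW: "real (card (U - W)) \<le> l ^ k"
    using assms(4,5) card_mono[of U "U - W"] by auto
  obtain V lab' where V: "V \<subseteq> U - W" "real (card (U - W)) \<le> l * real (card V)"
    "\<And>x. x \<in> V \<Longrightarrow> D x (lab' x) \<le> real k * \<rho>"
    "\<And>x y. x \<in> V \<Longrightarrow> y \<in> V \<Longrightarrow> D x y \<le> \<rho> \<Longrightarrow> lab' x = lab' y"
    using separated_clusters[of D "U - W" l k \<rho>, OF D0 Dtri Dsym finW cardW assms(6-8)] by blast
  have "U - (W \<union> V) = (U - W) - V" by auto
  then have "card (U - (W \<union> V)) = card (U - W) - card V"
    using V(1) assms(4) by (simp add: card_Diff_subset finite_subset)
  moreover have "card V \<le> card (U - W)"
    using V(1) assms(4) by (intro card_mono) auto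
  ultimately have "real (card (U - (W \<union> V))) = real (card (U - W)) - real (card V)"
    by simp
  also have "\<dots> \<le> (1 - 1 / l) * real (card (U - W))"
    using V(2) \<open>1 \<le> l\<close> by (simp add: field_simps)
  also have "\<dots> \<le> (1 - 1 / l) * ((1 - 1 / l) ^ m * real (card U))"
    using W(2) \<open>1 \<le> l\<close> by (intro mult_left_mono) auto
  finally have card: "real (card (U - (W \<union> V))) \<le> (1 - 1 / l) ^ Suc m * real (card U)"
    by simp
  have disj: "x \<notin> W" if "x \<in> V" for x using V(1) that by auto
  show ?case
  proof (intro exI[of _ "W \<union> V"] exI[of _ "\<lambda>x. if x \<in> W then col x else m"]
      exI[of _ "\<lambda>x. if x \<in> W then lab x else lab' x"] conjI ballI impI card)
    show "W \<union> V \<subseteq> U" using W(1) V(1) by auto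
  qed (use W(3,4) V(3,4) disj in \<open>auto split: if_splits simp: less_Suc_eq\<close>)
qed

text \<open>With \<open>l = exp (c / k)\<close> the cap \<open>l ^ k\<close> is
  \<open>exp c\<close>. After \<open>m\<close> rounds at most \<open>(1 - 1 / l) ^ m * exp c\<close>
  points are uncoloured; this is below 1 for the given \<open>m\<close>, so none is left.\<close>

lemma separated_colouring:
  fixes D :: "'a \<Rightarrow> 'a \<Rightarrow> real" and c \<rho> :: real
  assumes D0: "\<And>x. D x x = 0" and Dtri: "\<And>x y z. D x z \<le> D x y + D y z"
    and Dsym: "\<And>x y. D x y = D y x"
    and "finite U" and "real (card U) \<le> exp c" and "0 < k" and "0 \<le> c" and "0 \<le> \<rho>"
    and m: "exp (c / real k) * (c + 1) \<le> real m"
  shows "\<exists>(col :: 'a \<Rightarrow> nat) lab. (\<forall>x\<in>U. col x < m \<and> D x (lab x) \<le> real k * \<rho>) \<and>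
    (\<forall>x\<in>U. \<forall>y\<in>U. col x = col y \<longrightarrow> D x y \<le> \<rho> \<longrightarrow> lab x = lab y)"
proof -
  define l where "l = exp (c / real k)"
  have l: "1 \<le> l" using assms by (simp add: l_def)
  have lk: "l ^ k = exp c" using \<open>0 < k\<close> by (simp add: l_def exp_of_nat_mult[symmetric])
  obtain W col lab where W: "W \<subseteq> U" "real (card (U - W)) \<le> (1 - 1 / l) ^ m * real (card U)"
    "\<forall>x\<in>W. col x < m \<and> D x (lab x) \<le> real k * \<rho>"
    "\<forall>x\<in>W. \<forall>y\<in>W. col x = (col y :: nat) \<longrightarrow> D x y \<le> \<rho> \<longrightarrow> lab x = lab y"
    using separated_colouring_steps[of D U l k \<rho> m] assms l lk by metis
  have "(1 - 1 / l) ^ m \<le> exp (- (1 / l)) ^ m"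
    using l exp_ge_add_one_self[of "- (1 / l)"] by (intro power_mono) auto
  also have "\<dots> = exp (- (real m / l))"
    by (simp add: exp_of_nat_mult[symmetric])
  also have "\<dots> \<le> exp (- (c + 1))"
    using m l by (simp add: l_def[symmetric] field_simps)
  finally have "(1 - 1 / l) ^ m * real (card U) \<le> exp (- (c + 1)) * exp c"
    using assms by (intro mult_mono) auto
  also have "\<dots> = exp (- 1)" by (simp add: exp_add[symmetric])
  also have "\<dots> < 1" by simp
  finally have "card (U - W) = 0" using W(2) by linarith
  then have "W = U" using W(1) \<open>finite U\<close> by auto
  with W show ?thesis by blast
qed

section \<open>Bowen balls and separated sets\<close>

text \<open>The condition \<open>0 < e\<close> stems from the \<open>0\<close> put into the maximum,
  which gives \<open>n = 0\<close> a meaning: a ball of length 0 and positive radius is all of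
  \<open>X\<close>.\<close>

lemma dyn_dist_less_iff:
  "dyn_dist T n x y < e \<longleftrightarrow> 0 < e \<and> (\<forall>i<n. dist ((T ^^ i) x) ((T ^^ i) y) < e)"
  unfolding dyn_dist_def by (subst Max_less_iff) auto

lemma dyn_dist_le_iff:
  "dyn_dist T n x y \<le> e \<longleftrightarrow> 0 \<le> e \<and> (\<forall>i<n. dist ((T ^^ i) x) ((T ^^ i) y) \<le> e)"
  unfolding dyn_dist_def by (subst Max_le_iff) auto

lemma dyn_dist_nonneg: "0 \<le> dyn_dist T n x y"
  using dyn_dist_le_iff[of T n x y "dyn_dist T n x y"] by simp

lemma dist_le_dyn_dist: "i < n \<Longrightarrow> dist ((T ^^ i) x) ((T ^^ i) y) \<le> dyn_dist T n x y"
  using dyn_dist_le_iff[of T n x y "dyn_dist T n x y"] by simp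

lemma dyn_dist_self [simp]: "dyn_dist T n x x = 0"
  using dyn_dist_le_iff[of T n x x 0] dyn_dist_nonneg[of T n x x] by simp

lemma dyn_dist_commute: "dyn_dist T n x y = dyn_dist T n y x"
  by (simp add: dyn_dist_def dist_commute)

lemma dyn_dist_triangle: "dyn_dist T n x z \<le> dyn_dist T n x y + dyn_dist T n y z"
  unfolding dyn_dist_le_iff
proof (intro conjI allI impI)
  fix i assume i: "i < n"
  have "dist ((T ^^ i) x) ((T ^^ i) z)
      \<le> dist ((T ^^ i) x) ((T ^^ i) y) + dist ((T ^^ i) y) ((T ^^ i) z)"
    by (rule dist_triangle)
  also have "\<dots> \<le> dyn_dist T n x y + dyn_dist T n y z"
    by (intro add_mono dist_le_dyn_dist i)
  finally show "dist ((T ^^ i) x) ((T ^^ i) z) \<le> dyn_dist T n x y + dyn_dist T n y z" .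
qed (simp add: dyn_dist_nonneg)

lemma dyn_dist_mono: "m \<le> n \<Longrightarrow> dyn_dist T m x y \<le> dyn_dist T n x y"
  unfolding dyn_dist_le_iff[of T m] by (auto simp: dyn_dist_nonneg intro: dist_le_dyn_dist)

lemma bowen_ball_subset: "bowen_ball X T n x e \<subseteq> X"
  by (auto simp: bowen_ball_def)

lemma bowen_ball_antimono:
  "m \<le> n \<Longrightarrow> bowen_ball X T n x e \<subseteq> bowen_ball X T m x e"
  by (auto simp: bowen_ball_def intro: le_less_trans[OF dyn_dist_mono])

lemma bowen_ball_mono: "d \<le> e \<Longrightarrow> bowen_ball X T n x d \<subseteq> bowen_ball X T n x e"
  by (auto simp: bowen_ball_def)

lemma centre_in_bowen_ball: "x \<in> X \<Longrightarrow> 0 < e \<Longrightarrow> x \<in> bowen_ball X T n x e"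
  by (simp add: bowen_ball_def)

section \<open>Compact systems: separated sets, entropy and partitions\<close>

locale compact_dynamics =
  fixes X :: "'a::metric_space set" and T :: "'a \<Rightarrow> 'a"
  assumes compact_X: "compact X" and T_into: "T ` X \<subseteq> X" and cont_T: "continuous_on X T"
begin

lemma funpow_in: "x \<in> X \<Longrightarrow> (T ^^ i) x \<in> X"
  using T_into by (induction i) auto

lemma continuous_on_funpow: "continuous_on X (T ^^ i)"
proof (induction i)
  case (Suc i)
  have "continuous_on ((T ^^ i) ` X) T"
    using cont_T funpow_in by (auto intro: continuous_on_subset)
  then have "continuous_on X (T \<circ> (T ^^ i))"
    using Suc by (intro continuous_on_compose)
  then show ?case by simp
qed (simp add: continuous_on_id id_def)

lemma openin_bowen_ball:
  assumes "0 < e"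
  shows "openin (top_of_set X) (bowen_ball X T n x e)"
proof (induction n)
  case 0
  then show ?case using assms by (simp add: bowen_ball_def dyn_dist_less_iff)
next
  case (Suc n)
  have "bowen_ball X T (Suc n) x e
      = bowen_ball X T n x e \<inter> (X \<inter> (T ^^ n) -` ball ((T ^^ n) x) e)"
    by (auto simp: bowen_ball_def dyn_dist_less_iff less_Suc_eq)
  then show ?case
    using Suc continuous_openin_preimage_gen[OF continuous_on_funpow open_ball]
    by (metis openin_Int)
qed

lemma finite_bowen_net:
  assumes "0 < e"
  obtains C where "finite C" "C \<subseteq> X" "X \<subseteq> (\<Union>c\<in>C. bowen_ball X T n c e)"
proof -
  have "\<exists>U. open U \<and> bowen_ball X T n x e = X \<inter> U" for x
    using openin_bowen_ball[OF assms] by (auto simp: openin_open)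
  then obtain U where U: "\<And>x. open (U x)" "\<And>x. bowen_ball X T n x e = X \<inter> U x" by metis
  have "X \<subseteq> (\<Union>x\<in>X. U x)"
    using centre_in_bowen_ball[OF _ assms, of _ X T n] U(2) by blast
  then obtain C where "C \<subseteq> X" "finite C" "X \<subseteq> (\<Union>x\<in>C. U x)"
    using compactE_image[OF compact_X, of X U] U(1) by metis
  moreover from this have "X \<subseteq> (\<Union>c\<in>C. bowen_ball X T n c e)" by (auto simp: U(2))
  ultimately show ?thesis using that by simp
qed

text \<open>Two separated points cannot share a ball of radius \<open>e/2\<close>, so a finite cover
  by such balls bounds the cardinality.\<close>

lemma bounded_card_separated:
  assumes "0 < e"
  shows "\<exists>b. \<forall>E. finite E \<longrightarrow> separated_set X T n e E \<longrightarrow> card E \<le> b"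
proof -
  obtain C where C: "finite C" "C \<subseteq> X" "X \<subseteq> (\<Union>c\<in>C. bowen_ball X T n c (e/2))"
    using finite_bowen_net[of "e/2" n] assms by auto
  have "card E \<le> card C" if E: "finite E" "separated_set X T n e E" for E
  proof -
    have "\<forall>x\<in>E. \<exists>c\<in>C. x \<in> bowen_ball X T n c (e/2)"
      using E C by (auto simp: separated_set_def)
    then obtain c where c: "\<And>x. x \<in> E \<Longrightarrow> c x \<in> C \<and> x \<in> bowen_ball X T n (c x) (e/2)" by metis
    have "inj_on c E"
    proof (rule inj_onI, rule ccontr)
      fix x y assume xy: "x \<in> E" "y \<in> E" "c x = c y" "x \<noteq> y"
      then have "dyn_dist T n x y > e" using E by (auto simp: separated_set_def)
      moreover have "dyn_dist T n (c x) x < e/2" "dyn_dist T n (c x) y < e/2"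
        using c[of x] c[of y] xy by (auto simp: bowen_ball_def)
      ultimately show False
        using dyn_dist_triangle[of T n x y "c x"] dyn_dist_commute[of T n x "c x"] by linarith
    qed
    then show ?thesis using c C(1) by (intro card_inj_on_le[of c]) auto
  qed
  then show ?thesis by blast
qed

lemma max_separated_attained:
  assumes "0 < e"
  shows "\<exists>E. finite E \<and> separated_set X T n e E \<and> card E = max_separated X T n e \<and>
    (\<forall>E'. finite E' \<longrightarrow> separated_set X T n e E' \<longrightarrow> card E' \<le> card E)"
proof -
  let ?S = "{card E | E. finite E \<and> separated_set X T n e E}"
  obtain b where "\<And>E. finite E \<Longrightarrow> separated_set X T n e E \<Longrightarrow> card E \<le> b"
    using bounded_card_separated[OF assms, of n] by blast
  then have "?S \<subseteq> {..b}" by auto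
  then have fin: "finite ?S" by (rule finite_subset) simp
  have "card {} \<in> ?S" by (intro CollectI exI[of _ "{}"]) (simp add: separated_set_def)
  then have ne: "?S \<noteq> {}" by blast
  \<comment> \<open>On \<open>nat\<close> the supremum of a nonempty set is defined as its
    \<open>Max\<close>, which is an attained value only because \<open>?S\<close> is finite.\<close>
  have eq: "max_separated X T n e = Max ?S"
    unfolding max_separated_def Sup_nat_def by (simp only: ne if_False)
  then have "max_separated X T n e \<in> ?S" using Max_in[OF fin ne] by simp
  then obtain E where E: "finite E" "separated_set X T n e E" "card E = max_separated X T n e"
    by auto
  moreover have "card E' \<le> card E" if "finite E'" "separated_set X T n e E'" for E'
    unfolding E(3) eq using that by (intro Max_ge[OF fin]) blast
  ultimately show ?thesis by blast
qed

lemma card_le_max_separated: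
  assumes "0 < e" "finite E" "separated_set X T n e E"
  shows "card E \<le> max_separated X T n e"
proof -
  obtain E' :: "'a set" where "card E' = max_separated X T n e"
    "\<forall>E. finite E \<longrightarrow> separated_set X T n e E \<longrightarrow> card E \<le> card E'"
    using max_separated_attained[OF assms(1), of n] by metis
  with assms(2,3) show ?thesis by simp
qed

text \<open>A separated set of maximal cardinality spans: a point farther than \<open>e\<close> from
  all its members could be added.\<close>

lemma max_separated_net:
  assumes "0 < e"
  obtains U where "finite U" "U \<subseteq> X" "card U = max_separated X T n e"
    "\<And>x. x \<in> X \<Longrightarrow> \<exists>u\<in>U. dyn_dist T n x u \<le> e"
proof -
  obtain E where E: "finite E" "separated_set X T n e E" "card E = max_separated X T n e"
    "\<And>E'. finite E' \<Longrightarrow> separated_set X T n e E' \<Longrightarrow> card E' \<le> card E"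
    using max_separated_attained[OF assms, of n] by blast
  have "\<exists>u\<in>E. dyn_dist T n x u \<le> e" if x: "x \<in> X" for x
  proof (rule ccontr)
    assume neg: "\<not> ?thesis"
    then have "x \<notin> E" using assms by (metis dyn_dist_self less_imp_le)
    moreover have "separated_set X T n e (insert x E)"
      using neg E(2) x unfolding separated_set_def
      by (auto simp: not_le dyn_dist_commute[of T n _ x])
    ultimately show False using E(4)[of "insert x E"] E(1) by auto
  qed
  with E that show ?thesis by (auto simp: separated_set_def)
qed

lemma max_separated_antimono:
  assumes "0 < d" "d \<le> e"
  shows "max_separated X T n e \<le> max_separated X T n d"
proof -
  obtain E where E: "finite E" "separated_set X T n e E" "card E = max_separated X T n e"
    using max_separated_attained[of e n] assms by force
  then have "separated_set X T n d E" using assms by (fastforce simp: separated_set_def)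
  then show ?thesis using card_le_max_separated[OF assms(1) E(1)] E(3) by simp
qed

lemma max_separated_pos:
  assumes "X \<noteq> {}" "0 < e"
  shows "1 \<le> max_separated X T n e"
proof -
  obtain x where "x \<in> X" using assms by auto
  then have "separated_set X T n e {x}" by (auto simp: separated_set_def)
  then show ?thesis using card_le_max_separated[of e "{x}" n] assms by simp
qed

text \<open>The rate \<open>C\<close> does not depend on the scale \<open>e\<close>; this uniformity is the only use of finite entropy.\<close>
lemma max_separated_exp_bound:
  assumes ent: "top_entropy X T < \<infinity>" and ne: "X \<noteq> {}"
  obtains C where "0 < C"
    "\<And>e. 0 < e \<Longrightarrow> \<forall>\<^sub>F n in sequentially. real (max_separated X T n e) \<le> exp (C * real n)"
proof -
  define h where "h e = limsup (\<lambda>n. ereal (ln (real (max_separated X T n e)) / real n))" for e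
  have h_anti: "h e \<le> h d" if "0 < d" "d \<le> e" for d e
    unfolding h_def
  proof (intro Limsup_mono always_eventually allI)
    fix n
    have "0 < max_separated X T n e" "max_separated X T n e \<le> max_separated X T n d"
      using max_separated_antimono[of d e n] max_separated_pos[OF ne, of e n] that by auto
    then show "ereal (ln (real (max_separated X T n e)) / real n)
        \<le> ereal (ln (real (max_separated X T n d)) / real n)"
      by (auto intro!: divide_right_mono)
  qed
  \<comment> \<open>\<open>top_entropy\<close> is a \<open>Lim\<close>, so convergence has to be
    shown before its value is known. As \<open>h\<close> grows when the scale shrinks, the limit is
    the supremum and bounds \<open>h\<close> at every scale.\<close>
  have "(h \<longlongrightarrow> (SUP e\<in>{0<..}. h e)) (at_right 0)"
  proof (rule order_tendstoI)
    fix a assume "a < (SUP e\<in>{0<..}. h e)"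
    then obtain e where e: "0 < e" "a < h e" by (auto simp: less_SUP_iff)
    have "\<forall>\<^sub>F d in at_right 0. d \<in> {0<..<e}"
      using e(1) by (rule eventually_at_right_real)
    then show "\<forall>\<^sub>F d in at_right 0. a < h d"
      by eventually_elim (use e h_anti in \<open>auto intro: less_le_trans\<close>)
  next
    fix a assume a: "(SUP e\<in>{0<..}. h e) < a"
    have "\<forall>\<^sub>F d in at_right 0. d \<in> {0<..<1::real}"
      by (rule eventually_at_right_real) simp
    then show "\<forall>\<^sub>F d in at_right 0. h d < a"
      by eventually_elim (rule le_less_trans[OF SUP_upper a], simp)
  qed
  then have "top_entropy X T = (SUP e\<in>{0<..}. h e)"
    unfolding top_entropy_def h_def[symmetric] by (intro tendsto_Lim) auto
  then have le: "h e \<le> top_entropy X T" if "0 < e" for e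
    using that by (auto intro: SUP_upper)
  obtain C0 where C0: "top_entropy X T < ereal C0"
    using ereal_dense2[OF ent] by blast
  define C where "C = max C0 1"
  have "\<forall>\<^sub>F n in sequentially. real (max_separated X T n e) \<le> exp (C * real n)" if e: "0 < e" for e
  proof -
    have "top_entropy X T < ereal C"
      using C0 by (rule less_le_trans) (simp add: C_def)
    then have "h e < ereal C" using le[OF e] by order
    then have "\<forall>\<^sub>F n in sequentially. ereal (ln (real (max_separated X T n e)) / real n) < ereal C"
      unfolding h_def by (rule Limsup_lessD)
    then show ?thesis
      using eventually_gt_at_top[of 0]
    proof eventually_elim
      case (elim n)
      then have "ln (real (max_separated X T n e)) \<le> C * real n"
        by (simp add: field_simps)
      moreover have "0 < real (max_separated X T n e)"
        using max_separated_pos[OF ne e, of n] by simp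
      ultimately show ?case by (metis exp_le_cancel_iff exp_ln)
    qed
  qed
  then show ?thesis using that[of C] by (simp add: C_def)
qed

text \<open>A cell is given by the colour and label of a nearby point of a net at scale
  \<open>\<rho>/4\<close>. Points of a cell are within \<open>\<rho>/4 + k * \<rho>\<close> of their
  common label, whence the diameter. Net points chosen for one Bowen ball are at most
  \<open>\<rho>\<close> apart, so there the colour determines the label, and only \<open>m\<close>
  colours exist.\<close>

lemma bowen_partition:
  assumes "0 < k" "0 < \<rho>" "0 \<le> c" and card: "real (max_separated X T n (\<rho>/4)) \<le> exp c"
    and m: "exp (c / real k) * (c + 1) \<le> real m"
  obtains \<pi> :: "'a \<Rightarrow> nat \<times> 'a" where "finite (\<pi> ` X)"
    "\<And>x y. x \<in> X \<Longrightarrow> y \<in> X \<Longrightarrow> \<pi> x = \<pi> y \<Longrightarrow> dyn_dist T n x y \<le> 2 * real k * \<rho> + \<rho> / 2"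
    "\<And>x. card (\<pi> ` bowen_ball X T n x (\<rho>/4)) \<le> m"
proof -
  obtain U where U: "finite U" "U \<subseteq> X" "card U = max_separated X T n (\<rho>/4)"
    "\<And>x. x \<in> X \<Longrightarrow> \<exists>u\<in>U. dyn_dist T n x u \<le> \<rho>/4"
    by (rule max_separated_net[of "\<rho>/4" n]) (use assms in auto)
  have "\<exists>p. \<forall>x\<in>X. p x \<in> U \<and> dyn_dist T n x (p x) \<le> \<rho>/4"
    by (rule bchoice) (use U(4) in blast)
  then obtain p where p: "\<And>x. x \<in> X \<Longrightarrow> p x \<in> U" "\<And>x. x \<in> X \<Longrightarrow> dyn_dist T n x (p x) \<le> \<rho>/4"
    by blast
  have cardU: "real (card U) \<le> exp c" and \<rho>: "0 \<le> \<rho>"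
    using assms(2) card U(3) by auto
  obtain col :: "'a \<Rightarrow> nat" and lab where col: "\<And>x. x \<in> U \<Longrightarrow> col x < m"
    and lab: "\<And>x. x \<in> U \<Longrightarrow> dyn_dist T n x (lab x) \<le> real k * \<rho>"
    and sep: "\<And>x y. x \<in> U \<Longrightarrow> y \<in> U \<Longrightarrow> col x = col y \<Longrightarrow> dyn_dist T n x y \<le> \<rho> \<Longrightarrow> lab x = lab y"
    using separated_colouring[of "dyn_dist T n" U c k \<rho> m,
        OF dyn_dist_self dyn_dist_triangle dyn_dist_commute U(1) cardU assms(1,3) \<rho> m]
    by blast
  define \<pi> where "\<pi> x = (col (p x), lab (p x))" for x
  note tri = dyn_dist_triangle[of T n] and sym = dyn_dist_commute[of T n]
  show ?thesis
  proof (rule that[of \<pi>])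
    have "\<pi> ` X \<subseteq> (\<lambda>u. (col u, lab u)) ` U" using p(1) by (auto simp: \<pi>_def)
    then show "finite (\<pi> ` X)" by (rule finite_surj[OF U(1)])
  next
    fix x y assume xy: "x \<in> X" "y \<in> X" "\<pi> x = \<pi> y"
    then have "lab (p y) = lab (p x)" by (simp add: \<pi>_def)
    then have "dyn_dist T n (p x) (lab (p x)) \<le> real k * \<rho>" "dyn_dist T n (p y) (lab (p x)) \<le> real k * \<rho>"
      using xy p(1) lab[of "p x"] lab[of "p y"] by auto
    then show "dyn_dist T n x y \<le> 2 * real k * \<rho> + \<rho> / 2"
      using p(2)[OF xy(1)] p(2)[OF xy(2)] tri[of x y "p x"] tri[of "p x" y "p y"]
        tri[of "p x" "p y" "lab (p x)"] sym[of y "p y"] sym[of "p y" "lab (p x)"] by linarith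
  next
    fix x
    let ?B = "bowen_ball X T n x (\<rho>/4)"
    have "\<pi> y = \<pi> z" if yz: "y \<in> ?B" "z \<in> ?B" "fst (\<pi> y) = fst (\<pi> z)" for y z
    proof -
      from yz have X: "y \<in> X" "z \<in> X" and d: "dyn_dist T n x y < \<rho>/4" "dyn_dist T n x z < \<rho>/4"
        by (auto simp: bowen_ball_def)
      have "dyn_dist T n (p y) (p z) \<le> \<rho>"
        using d p(2)[OF X(1)] p(2)[OF X(2)] tri[of "p y" "p z" y] tri[of y "p z" x] tri[of x "p z" z]
          sym[of "p y" y] sym[of y x] by linarith
      then have "lab (p y) = lab (p z)" using yz sep p(1) X by (auto simp: \<pi>_def)
      with yz show ?thesis by (simp add: \<pi>_def)
    qed
    then have "inj_on fst (\<pi> ` ?B)" by (simp add: inj_on_def)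
    moreover have "fst ` \<pi> ` ?B \<subseteq> {..<m}"
      using p(1) col by (auto simp: \<pi>_def bowen_ball_def)
    ultimately have "card (\<pi> ` ?B) \<le> card {..<m}" by (intro card_inj_on_le) auto
    then show "card (\<pi> ` ?B) \<le> m" by simp
  qed
qed

end

section \<open>Bowen pressure\<close>

text \<open>The pressure need not be monotone in the scale, because the suprema over the balls
  shrink with it. Monotonicity up to an arbitrarily small error still forces the upper limit below
  the lower one.\<close>

lemma tendsto_at_right_almost_mono:
  fixes p :: "real \<Rightarrow> ereal"
  assumes "\<And>\<gamma>. 0 < \<gamma> \<Longrightarrow>
    \<exists>r>0. \<forall>d e. 0 < d \<longrightarrow> d \<le> e \<longrightarrow> e < r \<longrightarrow> p e \<le> p d + ereal \<gamma>"
  shows "(p \<longlongrightarrow> Limsup (at_right 0) p) (at_right 0)"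
proof -
  have "Limsup (at_right 0) p \<le> Liminf (at_right 0) p"
  proof (rule ereal_le_epsilon2)
    fix \<gamma> :: real assume "0 < \<gamma>"
    then obtain r where r: "0 < r"
      "\<And>d e. 0 < d \<Longrightarrow> d \<le> e \<Longrightarrow> e < r \<Longrightarrow> p e \<le> p d + ereal \<gamma>"
      using assms by blast
    have "p e - ereal \<gamma> \<le> Liminf (at_right 0) p" if "0 < e" "e < r" for e
    proof (rule Liminf_bounded)
      have "\<forall>\<^sub>F d in at_right 0. d \<in> {0<..<e}"
        using that(1) by (rule eventually_at_right_real)
      then show "\<forall>\<^sub>F d in at_right 0. p e - ereal \<gamma> \<le> p d"
      proof eventually_elim
        case (elim d)
        then have "p e \<le> p d + ereal \<gamma>" using r(2)[of d e] that by auto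
        then show ?case by (simp add: ereal_minus_le_iff add.commute)
      qed
    qed
    then have bound: "p e \<le> Liminf (at_right 0) p + ereal \<gamma>" if "0 < e" "e < r" for e
      using that by (simp add: ereal_minus_le_iff add.commute)
    show "Limsup (at_right 0) p \<le> Liminf (at_right 0) p + ereal \<gamma>"
    proof (rule Limsup_bounded)
      have "\<forall>\<^sub>F e in at_right 0. e \<in> {0<..<r}"
        using r(1) by (rule eventually_at_right_real)
      then show "\<forall>\<^sub>F e in at_right 0. p e \<le> Liminf (at_right 0) p + ereal \<gamma>"
        by eventually_elim (simp add: bound)
    qed
  qed
  moreover have "Liminf (at_right 0) p \<le> Limsup (at_right 0) p"
    by (rule Liminf_le_Limsup) simp
  ultimately show ?thesis
    by (intro Liminf_eq_Limsup) auto
qed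

lemma pressure_M_le:
  assumes "bowen_cover X T Z N e I c k"
  shows "pressure_M X T f Z s N e \<le> (\<Sum>i. if i \<in> I then
    ennreal (exp (- s * real (k i) + Sup (birkhoff_sum T f (k i) ` bowen_ball X T (k i) (c i) e))) else 0)"
  unfolding pressure_M_def by (rule Inf_lower) (use assms in blast)

lemma pressure_M_greatest:
  assumes "\<And>I c k. bowen_cover X T Z N e I c k \<Longrightarrow> b \<le> (\<Sum>i. if i \<in> I then
    ennreal (exp (- s * real (k i) + Sup (birkhoff_sum T f (k i) ` bowen_ball X T (k i) (c i) e))) else 0)"
  shows "b \<le> pressure_M X T f Z s N e"
  unfolding pressure_M_def by (rule Inf_greatest) (use assms in blast)

lemma pressure_M_mono_set:
  "Y \<subseteq> Z \<Longrightarrow> pressure_M X T f Y s N e \<le> pressure_M X T f Z s N e"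
  by (rule pressure_M_greatest, rule pressure_M_le) (auto simp: bowen_cover_def)

lemma pressure_M_mono_level:
  "M \<le> N \<Longrightarrow> pressure_M X T f Z s M e \<le> pressure_M X T f Z s N e"
  by (rule pressure_M_greatest, rule pressure_M_le) (auto simp: bowen_cover_def intro: order_trans)

lemma pressure_M_antimono_exponent:
  assumes "s \<le> t"
  shows "pressure_M X T f Z t N e \<le> pressure_M X T f Z s N e"
proof (rule pressure_M_greatest)
  fix I c k assume "bowen_cover X T Z N e I c k"
  then have "pressure_M X T f Z t N e \<le> (\<Sum>i. if i \<in> I then
    ennreal (exp (- t * real (k i) + Sup (birkhoff_sum T f (k i) ` bowen_ball X T (k i) (c i) e))) else 0)"
    by (rule pressure_M_le)
  also have "\<dots> \<le> (\<Sum>i. if i \<in> I then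
    ennreal (exp (- s * real (k i) + Sup (birkhoff_sum T f (k i) ` bowen_ball X T (k i) (c i) e))) else 0)"
    using assms by (intro suminf_le) (auto intro!: ennreal_leI mult_right_mono)
  finally show "pressure_M X T f Z t N e \<le> (\<Sum>i. if i \<in> I then
    ennreal (exp (- s * real (k i) + Sup (birkhoff_sum T f (k i) ` bowen_ball X T (k i) (c i) e))) else 0)" .
qed

lemma bowen_pressure_eps_mono:
  assumes "Y \<subseteq> Z"
  shows "bowen_pressure_eps X T f Y e \<le> bowen_pressure_eps X T f Z e"
proof -
  have "pressure_m X T f Y s e \<le> pressure_m X T f Z s e" for s
    unfolding pressure_m_def by (intro SUP_mono) (use pressure_M_mono_set[OF assms] in blast)
  then have "pressure_m X T f Y s e = 0" if "pressure_m X T f Z s e = 0" for s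
    using that by (metis le_zero_eq)
  then show ?thesis
    unfolding bowen_pressure_eps_def by (intro Inf_superset_mono) auto
qed

text \<open>Positivity at one level suffices: \<open>pressure_m\<close> is a supremum over levels,
  and the sums do not increase with the exponent, so no exponent below \<open>s\<close> gives
  0.\<close>

lemma le_bowen_pressure_eps:
  assumes "0 < pressure_M X T f Z s N e"
  shows "ereal s \<le> bowen_pressure_eps X T f Z e"
  unfolding bowen_pressure_eps_def
proof (rule Inf_greatest, clarify)
  fix t assume t: "pressure_m X T f Z t e = 0"
  have "s \<le> t"
  proof (rule ccontr)
    assume "\<not> s \<le> t"
    then have "pressure_M X T f Z s N e \<le> pressure_M X T f Z t N e"
      by (intro pressure_M_antimono_exponent) simp
    also have "\<dots> \<le> pressure_m X T f Z t e"
      unfolding pressure_m_def by (rule SUP_upper) simp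
    finally show False using t assms by simp
  qed
  then show "ereal s \<le> ereal t" by simp
qed

lemma pressure_M_pos:
  assumes "ereal s < bowen_pressure_eps X T f Z e"
  shows "\<exists>N. 0 < pressure_M X T f Z s N e"
proof (rule ccontr)
  assume "\<nexists>N. 0 < pressure_M X T f Z s N e"
  then have "pressure_m X T f Z s e = 0"
    unfolding pressure_m_def by (simp add: zero_less_iff_neq_zero)
  then have "bowen_pressure_eps X T f Z e \<le> ereal s"
    unfolding bowen_pressure_eps_def by (intro Inf_lower) auto
  with assms show False by simp
qed

section \<open>Bowen pressure of a continuous potential\<close>

locale compact_dynamics_potential = compact_dynamics X T
  for X :: "'a::metric_space set" and T :: "'a \<Rightarrow> 'a" +
  fixes f :: "'a \<Rightarrow> real"
  assumes cont_f: "continuous_on X f"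
begin

lemma f_bounded: "\<exists>F\<ge>0. \<forall>x\<in>X. \<bar>f x\<bar> \<le> F"
proof -
  have "bounded (f ` X)"
    using compact_X cont_f by (intro compact_imp_bounded compact_continuous_image)
  then obtain F where "\<And>x. x \<in> X \<Longrightarrow> \<bar>f x\<bar> \<le> F"
    by (auto simp: bounded_iff)
  then have "\<bar>f x\<bar> \<le> max F 0" if "x \<in> X" for x using that by fastforce
  then show ?thesis by (intro exI[of _ "max F 0"]) auto
qed

lemma birkhoff_sum_bound:
  assumes "\<And>x. x \<in> X \<Longrightarrow> \<bar>f x\<bar> \<le> F" "x \<in> X"
  shows "\<bar>birkhoff_sum T f n x\<bar> \<le> real n * F"
proof -
  have "\<bar>birkhoff_sum T f n x\<bar> \<le> (\<Sum>i<n. \<bar>f ((T ^^ i) x)\<bar>)"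
    unfolding birkhoff_sum_def by (rule sum_abs)
  also have "\<dots> \<le> (\<Sum>i<n. F)"
    using assms funpow_in by (intro sum_mono) auto
  finally show ?thesis by simp
qed

lemma bdd_above_birkhoff:
  assumes "S \<subseteq> X"
  shows "bdd_above (birkhoff_sum T f n ` S)"
proof -
  obtain F where F: "\<And>x. x \<in> X \<Longrightarrow> \<bar>f x\<bar> \<le> F" using f_bounded by blast
  show ?thesis
  proof (rule bdd_aboveI2)
    fix x assume "x \<in> S"
    then show "birkhoff_sum T f n x \<le> real n * F"
      using birkhoff_sum_bound[OF F, of x n] assms by auto
  qed
qed

text \<open>Uniform continuity of \<open>f\<close>, summed along orbits. The error is linear in
  \<open>n\<close>, so a shift of the exponent by \<open>\<gamma>\<close> can absorb it.\<close>

lemma birkhoff_oscillation: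
  assumes "0 < \<gamma>"
  shows "\<exists>r>0. \<forall>n. \<forall>x\<in>X. \<forall>y\<in>X. dyn_dist T n x y < r \<longrightarrow>
    birkhoff_sum T f n x \<le> birkhoff_sum T f n y + real n * \<gamma>"
proof -
  have "uniformly_continuous_on X f"
    by (rule compact_uniformly_continuous[OF cont_f compact_X])
  then obtain r where r: "0 < r" "\<And>x y. x \<in> X \<Longrightarrow> y \<in> X \<Longrightarrow> dist x y < r \<Longrightarrow> dist (f x) (f y) < \<gamma>"
    using assms unfolding uniformly_continuous_on_def by metis
  have "birkhoff_sum T f n x \<le> birkhoff_sum T f n y + real n * \<gamma>"
    if "x \<in> X" "y \<in> X" "dyn_dist T n x y < r" for n x y
  proof -
    have "f ((T ^^ i) x) \<le> f ((T ^^ i) y) + \<gamma>" if "i < n" for i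
      using r(2)[of "(T ^^ i) x" "(T ^^ i) y"] that \<open>x \<in> X\<close> \<open>y \<in> X\<close> funpow_in
        \<open>dyn_dist T n x y < r\<close> unfolding dyn_dist_less_iff dist_real_def by fastforce
    then have "(\<Sum>i<n. f ((T ^^ i) x)) \<le> (\<Sum>i<n. f ((T ^^ i) y) + \<gamma>)"
      by (intro sum_mono) auto
    then show ?thesis by (simp add: birkhoff_sum_def sum.distrib)
  qed
  with r(1) show ?thesis by blast
qed

text \<open>The same centres and lengths give a cover at the larger scale. On the larger ball the
  Birkhoff sum exceeds its value at the centre, a point of the smaller ball, by at most
  \<open>n * \<gamma>\<close>.\<close>

lemma pressure_M_change_scale:
  assumes osc: "\<And>n x y. x \<in> X \<Longrightarrow> y \<in> X \<Longrightarrow> dyn_dist T n x y < e \<Longrightarrow>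
      birkhoff_sum T f n x \<le> birkhoff_sum T f n y + real n * \<gamma>"
    and "0 < d" "d \<le> e"
  shows "pressure_M X T f Z (s + \<gamma>) N e \<le> pressure_M X T f Z s N d"
proof (rule pressure_M_greatest)
  fix I c k assume cov: "bowen_cover X T Z N d I c k"
  have "(\<Union>i\<in>I. bowen_ball X T (k i) (c i) d) \<subseteq> (\<Union>i\<in>I. bowen_ball X T (k i) (c i) e)"
    by (intro UN_mono order_refl bowen_ball_mono assms(3))
  with cov have "bowen_cover X T Z N e I c k"
    unfolding bowen_cover_def by (meson order_trans)
  then have "pressure_M X T f Z (s + \<gamma>) N e \<le> (\<Sum>i. if i \<in> I then
    ennreal (exp (- (s + \<gamma>) * real (k i) + Sup (birkhoff_sum T f (k i) ` bowen_ball X T (k i) (c i) e))) else 0)"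
    by (rule pressure_M_le)
  also have "\<dots> \<le> (\<Sum>i. if i \<in> I then
    ennreal (exp (- s * real (k i) + Sup (birkhoff_sum T f (k i) ` bowen_ball X T (k i) (c i) d))) else 0)"
  proof (intro suminf_le)
    fix i
    have "Sup (birkhoff_sum T f (k i) ` bowen_ball X T (k i) (c i) e)
        \<le> Sup (birkhoff_sum T f (k i) ` bowen_ball X T (k i) (c i) d) + real (k i) * \<gamma>" if "i \<in> I"
    proof (rule cSUP_least)
      have c: "c i \<in> X" using cov that by (auto simp: bowen_cover_def)
      then have cd: "c i \<in> bowen_ball X T (k i) (c i) d"
        using assms(2) by (rule centre_in_bowen_ball)
      then show "bowen_ball X T (k i) (c i) e \<noteq> {}"
        using bowen_ball_mono[OF assms(3)] by blast
      fix y assume "y \<in> bowen_ball X T (k i) (c i) e"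
      then have "birkhoff_sum T f (k i) y \<le> birkhoff_sum T f (k i) (c i) + real (k i) * \<gamma>"
        using c dyn_dist_commute[of T "k i" y "c i"] by (intro osc) (auto simp: bowen_ball_def)
      also have "birkhoff_sum T f (k i) (c i) \<le> Sup (birkhoff_sum T f (k i) ` bowen_ball X T (k i) (c i) d)"
        by (rule cSUP_upper[OF cd bdd_above_birkhoff[OF bowen_ball_subset]])
      finally show "birkhoff_sum T f (k i) y \<le>
          Sup (birkhoff_sum T f (k i) ` bowen_ball X T (k i) (c i) d) + real (k i) * \<gamma>" by simp
    qed
    then show "(if i \<in> I then ennreal (exp (- (s + \<gamma>) * real (k i) + Sup (birkhoff_sum T f (k i) ` bowen_ball X T (k i) (c i) e))) else 0)
      \<le> (if i \<in> I then ennreal (exp (- s * real (k i) + Sup (birkhoff_sum T f (k i) ` bowen_ball X T (k i) (c i) d))) else 0)"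
      by (auto intro!: ennreal_leI simp: algebra_simps)
  qed auto
  finally show "pressure_M X T f Z (s + \<gamma>) N e \<le> (\<Sum>i. if i \<in> I then
    ennreal (exp (- s * real (k i) + Sup (birkhoff_sum T f (k i) ` bowen_ball X T (k i) (c i) d))) else 0)" .
qed

lemma bowen_pressure_eps_almost_mono:
  assumes "0 < \<gamma>"
  shows "\<exists>r>0. \<forall>d e. 0 < d \<longrightarrow> d \<le> e \<longrightarrow> e < r \<longrightarrow>
    bowen_pressure_eps X T f Z e \<le> bowen_pressure_eps X T f Z d + ereal \<gamma>"
proof -
  obtain r where r: "0 < r" "\<And>n x y. x \<in> X \<Longrightarrow> y \<in> X \<Longrightarrow> dyn_dist T n x y < r \<Longrightarrow>
      birkhoff_sum T f n x \<le> birkhoff_sum T f n y + real n * \<gamma>"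
    using birkhoff_oscillation[OF assms] by blast
  have "bowen_pressure_eps X T f Z e \<le> bowen_pressure_eps X T f Z d + ereal \<gamma>"
    if de: "0 < d" "d \<le> e" "e < r" for d e
  proof -
    have "bowen_pressure_eps X T f Z e - ereal \<gamma> \<le> bowen_pressure_eps X T f Z d"
      unfolding bowen_pressure_eps_def[of X T f Z d]
    proof (rule Inf_greatest, clarify)
      fix s assume s: "pressure_m X T f Z s d = 0"
      have "pressure_M X T f Z (s + \<gamma>) N e \<le> pressure_M X T f Z s N d" for N
        by (rule pressure_M_change_scale[OF r(2)]) (use de in auto)
      then have "pressure_m X T f Z (s + \<gamma>) e \<le> pressure_m X T f Z s d"
        unfolding pressure_m_def by (intro SUP_mono) blast
      then have "pressure_m X T f Z (s + \<gamma>) e = 0" using s by simp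
      then have "bowen_pressure_eps X T f Z e \<le> ereal (s + \<gamma>)"
        unfolding bowen_pressure_eps_def by (intro Inf_lower) auto
      then show "bowen_pressure_eps X T f Z e - ereal \<gamma> \<le> ereal s"
        by (simp add: ereal_minus_le_iff)
    qed
    then show ?thesis by (simp add: ereal_minus_le_iff add.commute)
  qed
  with r(1) show ?thesis by blast
qed

text \<open>Shows that the \<open>Lim\<close> in the definition is a genuine limit, so that bounds
  at small scales pass to \<open>bowen_pressure\<close>.\<close>

lemma bowen_pressure_tendsto:
  "((\<lambda>e. bowen_pressure_eps X T f Z e) \<longlongrightarrow> bowen_pressure X T f Z) (at_right 0)"
proof -
  let ?p = "\<lambda>e. bowen_pressure_eps X T f Z e"
  have "(?p \<longlongrightarrow> Limsup (at_right 0) ?p) (at_right 0)"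
    by (rule tendsto_at_right_almost_mono) (rule bowen_pressure_eps_almost_mono)
  moreover from this have "bowen_pressure X T f Z = Limsup (at_right 0) ?p"
    unfolding bowen_pressure_def by (intro tendsto_Lim) auto
  ultimately show ?thesis by simp
qed

lemma bowen_pressure_mono:
  assumes "Y \<subseteq> Z"
  shows "bowen_pressure X T f Y \<le> bowen_pressure X T f Z"
  by (rule tendsto_le[OF _ bowen_pressure_tendsto bowen_pressure_tendsto])
    (simp_all add: bowen_pressure_eps_mono[OF assms])

text \<open>At a scale where the oscillation is already small, one positive sum controls all smaller
  scales at the price of a single \<open>\<gamma>\<close>, hence also the limit.\<close>

lemma bowen_pressure_eps_le:
  assumes osc: "\<And>n x y. x \<in> X \<Longrightarrow> y \<in> X \<Longrightarrow> dyn_dist T n x y < e \<Longrightarrow>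
      birkhoff_sum T f n x \<le> birkhoff_sum T f n y + real n * \<gamma>"
    and "0 < e" and pos: "0 < pressure_M X T f Z (s + \<gamma>) N e"
  shows "ereal s \<le> bowen_pressure X T f Z"
proof (rule tendsto_lowerbound[OF bowen_pressure_tendsto])
  have "\<forall>\<^sub>F d in at_right 0. d \<in> {0<..<e}"
    using assms(2) by (rule eventually_at_right_real)
  then show "\<forall>\<^sub>F d in at_right 0. ereal s \<le> bowen_pressure_eps X T f Z d"
  proof eventually_elim
    case (elim d)
    have "pressure_M X T f Z (s + \<gamma>) N e \<le> pressure_M X T f Z s N d"
      by (rule pressure_M_change_scale[OF osc]) (use elim in auto)
    with pos show ?case by (intro le_bowen_pressure_eps[of _ _ _ _ _ N]) (rule less_le_trans)
  qed
qed simp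

end

section \<open>The tree of cells\<close>

text \<open>An integer substitute for a geometric sequence of ratio \<open>1 + 1/q\<close>; it
  increases strictly when \<open>0 < q\<close> and \<open>q \<le> v\<close>.\<close>

primrec sparse_level :: "nat \<Rightarrow> nat \<Rightarrow> nat \<Rightarrow> nat" where
  "sparse_level q v 0 = v"
| "sparse_level q v (Suc k) = sparse_level q v k + sparse_level q v k div q"

lemma sparse_level_ge: "v \<le> sparse_level q v k"
  by (induction k) auto

lemma sparse_level_mono: "j \<le> k \<Longrightarrow> sparse_level q v j \<le> sparse_level q v k"
  by (induction k) (auto simp: le_Suc_eq)

text \<open>As every level \<open>n\<close> is at least \<open>q\<close>, rounding loses at most
  half: \<open>n \<le> 2 * q * (n div q)\<close>. So the growth of the right-hand side pays for each
  new summand.\<close>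

lemma sum_sparse_level:
  assumes "0 < q" "q \<le> v"
  shows "(\<Sum>j<k. sparse_level q v j) \<le> 2 * q * sparse_level q v k"
proof (induction k)
  case (Suc k)
  let ?n = "sparse_level q v k"
  have "1 \<le> ?n div q"
    using assms sparse_level_ge[of v q k] div_le_mono[of q ?n q] by simp
  then have "q \<le> q * (?n div q)" by simp
  moreover have "?n = q * (?n div q) + ?n mod q" by simp
  moreover have "?n mod q < q" using assms by simp
  ultimately have "?n \<le> 2 * (q * (?n div q))" by linarith
  with Suc show ?case by (simp add: algebra_simps)
qed simp

lemma exists_sparse_level:
  assumes "0 < q" "q \<le> v" "v \<le> n"
  shows "\<exists>k. sparse_level q v k \<le> n \<and> n < sparse_level q v (Suc k)"
proof -
  have "v + k \<le> sparse_level q v k" for k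
  proof (induction k)
    case (Suc k)
    have "1 \<le> sparse_level q v k div q"
      using assms sparse_level_ge[of v q k] div_le_mono[of q "sparse_level q v k" q] by simp
    with Suc show ?case by simp
  qed simp
  from this[of "Suc n"] have "n < sparse_level q v (Suc n)" by linarith
  then obtain k where "n < sparse_level q v k" "\<And>j. j < k \<Longrightarrow> \<not> n < sparse_level q v j"
    using exists_least_iff[of "\<lambda>k. n < sparse_level q v k"] by blast
  moreover from this have "k \<noteq> 0" using assms(3) by (cases k) auto
  ultimately show ?thesis by (metis lessI not_less not0_implies_Suc)
qed

text \<open>The cells of the common refinement of the partitions into fibres of
  \<open>\<pi> 0\<close> up to \<open>\<pi> k\<close>, hence nested in \<open>k\<close>.\<close>

definition cell :: "'a set \<Rightarrow> (nat \<Rightarrow> 'a \<Rightarrow> 'b) \<Rightarrow> nat \<Rightarrow> 'a \<Rightarrow> 'a set" where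
  "cell X \<pi> k x = {y \<in> X. \<forall>j\<le>k. \<pi> j y = \<pi> j x}"

definition cell_nodes :: "'a set \<Rightarrow> (nat \<Rightarrow> 'a \<Rightarrow> 'b) \<Rightarrow> (nat \<times> 'a set) set" where
  "cell_nodes X \<pi> = (\<Union>k. Pair k ` (cell X \<pi> k ` X))"

lemma cell_self: "x \<in> X \<Longrightarrow> x \<in> cell X \<pi> k x"
  by (simp add: cell_def)

lemma cell_subset: "cell X \<pi> k x \<subseteq> X"
  by (auto simp: cell_def)

lemma laminar_cell_nodes: "laminar (cell_nodes X \<pi>)"
proof -
  have "cell X \<pi> l y \<subseteq> cell X \<pi> k x" if "k \<le> l" "z \<in> cell X \<pi> k x" "z \<in> cell X \<pi> l y" for k l x y z
  proof
    fix u assume "u \<in> cell X \<pi> l y"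
    then have "u \<in> X" "\<pi> j u = \<pi> j x" if "j \<le> k" for j
      using that \<open>k \<le> l\<close> \<open>z \<in> cell X \<pi> k x\<close> \<open>z \<in> cell X \<pi> l y\<close>
      by (auto simp: cell_def)
    then show "u \<in> cell X \<pi> k x" by (auto simp: cell_def)
  qed
  then show ?thesis unfolding laminar_def cell_nodes_def by fastforce
qed

text \<open>A cell is determined by its itinerary under \<open>\<pi> 0\<close> to
  \<open>\<pi> k\<close>, and the itineraries of points of \<open>S\<close> lie in a finite
  product.\<close>

lemma card_cells_le:
  assumes "\<And>j. finite (\<pi> j ` S)"
  shows "finite (cell X \<pi> k ` S)" "card (cell X \<pi> k ` S) \<le> (\<Prod>j\<le>k. card (\<pi> j ` S))"
proof -
  define \<tau> where "\<tau> y = restrict (\<lambda>j. \<pi> j y) {..k}" for y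
  have sub: "\<tau> ` S \<subseteq> (\<Pi>\<^sub>E j\<in>{..k}. \<pi> j ` S)"
    unfolding \<tau>_def by (intro image_subsetI) (simp add: restrict_PiE_iff)
  have fin: "finite (\<Pi>\<^sub>E j\<in>{..k}. \<pi> j ` S)"
    using assms by (intro finite_PiE) auto
  have "(\<tau> y = \<tau> x) \<longleftrightarrow> (\<forall>j\<le>k. \<pi> j y = \<pi> j x)" for x y
    unfolding \<tau>_def by (auto simp: fun_eq_iff restrict_def)
  then have "cell X \<pi> k x = {y \<in> X. \<tau> y = \<tau> x}" for x
    by (simp add: cell_def)
  then have eq: "cell X \<pi> k ` S = (\<lambda>t. {y \<in> X. \<tau> y = t}) ` (\<tau> ` S)"
    by (simp add: image_image)
  have fin\<tau>: "finite (\<tau> ` S)" using sub fin by (rule finite_subset)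
  then show "finite (cell X \<pi> k ` S)" unfolding eq by simp
  have "card (cell X \<pi> k ` S) \<le> card (\<tau> ` S)"
    unfolding eq using fin\<tau> by (rule card_image_le)
  also have "\<dots> \<le> card (\<Pi>\<^sub>E j\<in>{..k}. \<pi> j ` S)"
    using fin sub by (rule card_mono)
  also have "\<dots> = (\<Prod>j\<le>k. card (\<pi> j ` S))"
    by (simp add: card_PiE)
  finally show "card (cell X \<pi> k ` S) \<le> (\<Prod>j\<le>k. card (\<pi> j ` S))" .
qed

lemma countable_cell_nodes:
  assumes "\<And>j. finite (\<pi> j ` X)"
  shows "countable (cell_nodes X \<pi>)"
proof -
  have "finite (cell X \<pi> k ` X)" for k
    by (rule card_cells_le(1), rule assms)
  then have "countable (Pair k ` (cell X \<pi> k ` X))" for k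
    by (rule countable_image[OF countable_finite])
  then show ?thesis
    unfolding cell_nodes_def by (intro countable_UN) auto
qed

lemma emeasure_node_cost:
  "emeasure (node_cost w) I = (\<integral>\<^sup>+a. w a \<partial>count_space I)"
  unfolding node_cost_def
  by (subst emeasure_density) (simp_all add: nn_integral_count_space_indicator)

lemma emeasure_node_cost_le:
  assumes "finite R" "\<And>a. a \<in> R \<Longrightarrow> w a \<le> b"
  shows "emeasure (node_cost w) R \<le> of_nat (card R) * b"
proof -
  have "emeasure (node_cost w) R = (\<Sum>a\<in>R. w a)"
    unfolding emeasure_node_cost using assms(1) by (rule nn_integral_count_space_finite)
  also have "\<dots> \<le> (\<Sum>a\<in>R. b)"
    using assms(2) by (rule sum_mono)
  finally show ?thesis by simp
qed

text \<open>Links families of nodes to the covers in \<open>pressure_M\<close>, which are indexed by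
  sets of natural numbers.\<close>

lemma suminf_reindex_node_cost:
  fixes h :: "nat \<Rightarrow> ennreal"
  assumes "inj_on e I" "\<And>a. a \<in> I \<Longrightarrow> h (e a) \<le> w a"
  shows "(\<Sum>i. if i \<in> e ` I then h i else 0) \<le> emeasure (node_cost w) I"
proof -
  have "(\<Sum>i. if i \<in> e ` I then h i else 0) = (\<integral>\<^sup>+i. (if i \<in> e ` I then h i else 0) \<partial>count_space UNIV)"
    by (rule nn_integral_count_space_nat[symmetric])
  also have "\<dots> = (\<integral>\<^sup>+i. h i * indicator (e ` I) i \<partial>count_space UNIV)"
    by (intro nn_integral_cong) (auto simp: indicator_def)
  also have "\<dots> = (\<integral>\<^sup>+i. h i \<partial>count_space (e ` I))"
    by (rule nn_integral_count_space_indicator[symmetric]) simp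
  also have "\<dots> = (\<integral>\<^sup>+a. h (e a) \<partial>count_space I)"
    using assms(1) by (intro nn_integral_bij_count_space[symmetric] inj_on_imp_bij_betw)
  also have "\<dots> \<le> (\<integral>\<^sup>+a. w a \<partial>count_space I)"
    using assms(2) by (intro nn_integral_mono) simp
  finally show ?thesis unfolding emeasure_node_cost .
qed

lemma exp_beats_linear_factor:
  assumes "0 < (a::real)" "0 < C"
  shows "\<forall>\<^sub>F n in sequentially. exp (a * real n) * (C * real n + 1) + 1 \<le> exp (2 * a * real n)"
  using eventually_ge_at_top[of "nat \<lceil>4 * C / a\<^sup>2\<rceil>"] eventually_ge_at_top[of "nat \<lceil>1 / a\<rceil>"]
proof eventually_elim
  case (elim n)
  let ?x = "real n"
  \<comment> \<open>The two thresholds are those making \<open>C * x \<le> (a * x)^2 / 4\<close> and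
    \<open>2 \<le> 1 + a * x\<close>; the right-hand sides add up to
    \<open>(1 + a * x / 2)^2\<close>.\<close>
  have "4 * C / a\<^sup>2 \<le> ?x" "1 / a \<le> ?x" using elim by linarith+
  then have x: "4 * C \<le> a\<^sup>2 * ?x" "1 \<le> a * ?x"
    using assms by (simp_all add: field_simps)
  have "4 * C * ?x \<le> a\<^sup>2 * ?x * ?x" using x(1) by (intro mult_right_mono) auto
  then have "C * ?x + 2 \<le> (1 + a * ?x / 2)\<^sup>2"
    using x(2) by (simp add: power2_eq_square algebra_simps)
  also have "\<dots> \<le> (exp (a * ?x / 2))\<^sup>2"
    using assms exp_ge_add_one_self[of "a * ?x / 2"] by (intro power_mono) auto
  also have "\<dots> = exp (a * ?x)"
    by (simp add: exp_double[symmetric])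
  finally have le: "C * ?x + 2 \<le> exp (a * ?x)" .
  have "exp (a * ?x) * (C * ?x + 1) + 1 \<le> exp (a * ?x) * (C * ?x + 2)"
    using assms by (simp add: algebra_simps)
  also have "\<dots> \<le> exp (a * ?x) * exp (a * ?x)"
    using le by (intro mult_left_mono) auto
  also have "\<dots> = exp (2 * a * ?x)"
    by (simp add: exp_add[symmetric])
  finally show ?case .
qed

section \<open>Comparison of the cell content with the pressure sums\<close>

context compact_dynamics_potential
begin

text \<open>The supremum runs over the cell, not over a Bowen ball, so the weight depends on the
  node alone.\<close>

definition cell_weight :: "(nat \<Rightarrow> nat) \<Rightarrow> real \<Rightarrow> nat \<times> 'a set \<Rightarrow> ennreal" where
  "cell_weight \<nu> \<sigma> a =
    ennreal (exp (- \<sigma> * real (\<nu> (fst a)) + Sup (birkhoff_sum T f (\<nu> (fst a)) ` snd a)))"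

text \<open>A cell of depth \<open>k\<close> lies in the Bowen ball of length \<open>\<nu> k\<close>
  and radius \<open>\<Delta>\<close> about any of its points. The supremum over that ball exceeds
  the one over the cell by at most \<open>\<nu> k * \<gamma>\<close>.\<close>

lemma pressure_M_le_node_content:
  assumes fin: "\<And>j. finite (\<pi> j ` X)"
    and diam: "\<And>k x y. x \<in> X \<Longrightarrow> y \<in> X \<Longrightarrow> \<pi> k x = \<pi> k y \<Longrightarrow> dyn_dist T (\<nu> k) x y < \<Delta>"
    and osc: "\<And>n x y. x \<in> X \<Longrightarrow> y \<in> X \<Longrightarrow> dyn_dist T n x y < \<Delta> \<Longrightarrow>
      birkhoff_sum T f n x \<le> birkhoff_sum T f n y + real n * \<gamma>"
    and "0 < \<Delta>" and N: "\<And>k. N \<le> \<nu> k"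
  shows "pressure_M X T f A (\<sigma> + \<gamma>) N \<Delta> \<le> node_content (cell_nodes X \<pi>) (cell_weight \<nu> \<sigma>) A"
  unfolding node_content_def
proof (rule Inf_greatest, clarify)
  fix I assume I: "I \<subseteq> cell_nodes X \<pi>" "A \<subseteq> \<Union>(snd ` I)"
  let ?e = "to_nat_on (cell_nodes X \<pi>)" and ?d = "from_nat_into (cell_nodes X \<pi>)"
  have cnt: "countable (cell_nodes X \<pi>)" by (rule countable_cell_nodes[OF fin])
  have de: "?d (?e a) = a" if "a \<in> I" for a
    using that I(1) cnt by (intro from_nat_into_to_nat_on) auto
  have inj: "inj_on ?e I"
    using inj_on_to_nat_on[OF cnt] I(1) by (rule inj_on_subset)
  have "\<exists>x\<in>X. snd a = cell X \<pi> (fst a) x" if "a \<in> cell_nodes X \<pi>" for a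
    using that by (auto simp: cell_nodes_def)
  then obtain pt where pt: "\<And>a. a \<in> I \<Longrightarrow> pt a \<in> X" "\<And>a. a \<in> I \<Longrightarrow> snd a = cell X \<pi> (fst a) (pt a)"
    using I(1) by (metis subsetD)
  define c where "c i = pt (?d i)" for i
  define k where "k i = \<nu> (fst (?d i))" for i
  have ball: "snd a \<subseteq> bowen_ball X T (\<nu> (fst a)) (pt a) \<Delta>" if "a \<in> I" for a
    using pt[OF that] diam[of "pt a" _ "fst a"] by (auto simp: cell_def bowen_ball_def)
  have "bowen_cover X T A N \<Delta> (?e ` I) c k"
    unfolding bowen_cover_def
  proof (intro conjI ballI)
    fix i assume "i \<in> ?e ` I"
    then show "c i \<in> X" "N \<le> k i" using de pt(1) N by (auto simp: c_def k_def)
  next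
    show "A \<subseteq> (\<Union>i\<in>?e ` I. bowen_ball X T (k i) (c i) \<Delta>)"
    proof
      fix x assume "x \<in> A"
      then obtain a where a: "a \<in> I" "x \<in> snd a" using I(2) by auto
      then have "x \<in> bowen_ball X T (k (?e a)) (c (?e a)) \<Delta>"
        using ball[OF a(1)] de[OF a(1)] by (auto simp: c_def k_def)
      with a(1) show "x \<in> (\<Union>i\<in>?e ` I. bowen_ball X T (k i) (c i) \<Delta>)" by blast
    qed
  qed
  then have "pressure_M X T f A (\<sigma> + \<gamma>) N \<Delta> \<le> (\<Sum>i. if i \<in> ?e ` I then
      ennreal (exp (- (\<sigma> + \<gamma>) * real (k i) + Sup (birkhoff_sum T f (k i) ` bowen_ball X T (k i) (c i) \<Delta>))) else 0)"
    by (rule pressure_M_le)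
  also have "\<dots> \<le> emeasure (node_cost (cell_weight \<nu> \<sigma>)) I"
  proof (rule suminf_reindex_node_cost[OF inj])
    fix a assume a: "a \<in> I"
    let ?n = "\<nu> (fst a)"
    have x: "pt a \<in> snd a" using pt[OF a] by (simp add: cell_self)
    have bdd: "bdd_above (birkhoff_sum T f ?n ` snd a)"
      using pt(2)[OF a] by (intro bdd_above_birkhoff) (simp add: cell_subset)
    have "Sup (birkhoff_sum T f ?n ` bowen_ball X T ?n (pt a) \<Delta>)
        \<le> Sup (birkhoff_sum T f ?n ` snd a) + real ?n * \<gamma>"
    proof (rule cSUP_least)
      show "bowen_ball X T ?n (pt a) \<Delta> \<noteq> {}" using ball[OF a] x by blast
      fix y assume "y \<in> bowen_ball X T ?n (pt a) \<Delta>"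
      then have "birkhoff_sum T f ?n y \<le> birkhoff_sum T f ?n (pt a) + real ?n * \<gamma>"
        using pt(1)[OF a] dyn_dist_commute[of T ?n y "pt a"] by (intro osc) (auto simp: bowen_ball_def)
      also have "birkhoff_sum T f ?n (pt a) \<le> Sup (birkhoff_sum T f ?n ` snd a)"
        by (rule cSUP_upper[OF x bdd])
      finally show "birkhoff_sum T f ?n y \<le> Sup (birkhoff_sum T f ?n ` snd a) + real ?n * \<gamma>" by simp
    qed
    then show "ennreal (exp (- (\<sigma> + \<gamma>) * real (k (?e a)) + Sup (birkhoff_sum T f (k (?e a)) `
        bowen_ball X T (k (?e a)) (c (?e a)) \<Delta>))) \<le> cell_weight \<nu> \<sigma> a"
      unfolding cell_weight_def c_def k_def de[OF a]
      by (intro ennreal_leI) (simp add: algebra_simps)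
  qed
  finally show "pressure_M X T f A (\<sigma> + \<gamma>) N \<Delta> \<le> emeasure (node_cost (cell_weight \<nu> \<sigma>)) I" .
qed

text \<open>The opposite comparison: each ball of a cover is replaced by nodes that together cost no
  more than the ball.\<close>

lemma node_content_le_pressure_M:
  assumes cover: "\<And>x n. x \<in> X \<Longrightarrow> v \<le> n \<Longrightarrow> \<exists>R. R \<subseteq> \<N> \<and> bowen_ball X T n x r \<subseteq> \<Union>(snd ` R) \<and>
    emeasure (node_cost w) R \<le> ennreal (exp (- s * real n + Sup (birkhoff_sum T f n ` bowen_ball X T n x r)))"
  shows "node_content \<N> w A \<le> pressure_M X T f A s v r"
proof (rule pressure_M_greatest)
  fix I c k assume cov: "bowen_cover X T A v r I c k"
  have "\<forall>i\<in>I. \<exists>R. R \<subseteq> \<N> \<and> bowen_ball X T (k i) (c i) r \<subseteq> \<Union>(snd ` R) \<and>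
    emeasure (node_cost w) R \<le> ennreal (exp (- s * real (k i) + Sup (birkhoff_sum T f (k i) ` bowen_ball X T (k i) (c i) r)))"
    using cov by (intro ballI cover) (auto simp: bowen_cover_def)
  then obtain R where R: "\<And>i. i \<in> I \<Longrightarrow> R i \<subseteq> \<N>"
    "\<And>i. i \<in> I \<Longrightarrow> bowen_ball X T (k i) (c i) r \<subseteq> \<Union>(snd ` R i)"
    "\<And>i. i \<in> I \<Longrightarrow> emeasure (node_cost w) (R i)
      \<le> ennreal (exp (- s * real (k i) + Sup (birkhoff_sum T f (k i) ` bowen_ball X T (k i) (c i) r)))"
    by metis
  define R' where "R' i = (if i \<in> I then R i else {})" for i
  have "node_content \<N> w A \<le> emeasure (node_cost w) (\<Union>i. R' i)"
  proof (rule node_content_le)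
    show "(\<Union>i. R' i) \<subseteq> \<N>" using R(1) by (auto simp: R'_def split: if_splits)
    show "A \<subseteq> \<Union>(snd ` (\<Union>i. R' i))"
    proof
      fix x assume "x \<in> A"
      then obtain i where i: "i \<in> I" "x \<in> bowen_ball X T (k i) (c i) r"
        using cov by (auto simp: bowen_cover_def)
      then obtain a where "a \<in> R i" "x \<in> snd a" using R(2) by blast
      then have "a \<in> R' i" using i by (simp add: R'_def)
      with \<open>x \<in> snd a\<close> show "x \<in> \<Union>(snd ` (\<Union>i. R' i))" by blast
    qed
  qed
  also have "\<dots> \<le> (\<Sum>i. emeasure (node_cost w) (R' i))"
    by (rule emeasure_subadditive_countably) auto
  also have "\<dots> \<le> (\<Sum>i. if i \<in> I then
    ennreal (exp (- s * real (k i) + Sup (birkhoff_sum T f (k i) ` bowen_ball X T (k i) (c i) r))) else 0)"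
    by (intro suminf_le) (use R(3) in \<open>auto simp: R'_def\<close>)
  finally show "node_content \<N> w A \<le> (\<Sum>i. if i \<in> I then
    ennreal (exp (- s * real (k i) + Sup (birkhoff_sum T f (k i) ` bowen_ball X T (k i) (c i) r))) else 0)" .
qed

lemma birkhoff_sum_shorten:
  assumes F: "\<And>x. x \<in> X \<Longrightarrow> \<bar>f x\<bar> \<le> F" and "x \<in> X" "m \<le> n"
  shows "birkhoff_sum T f m x \<le> birkhoff_sum T f n x + (real n - real m) * F"
proof -
  have "birkhoff_sum T f n x = birkhoff_sum T f m x + (\<Sum>i=m..<n. f ((T ^^ i) x))"
    unfolding birkhoff_sum_def using sum.atLeastLessThan_concat[of 0 m n "\<lambda>i. f ((T ^^ i) x)"] assms(3)
    by (simp add: lessThan_atLeast0)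
  moreover have "- F \<le> f ((T ^^ i) x)" for i
    using F[of "(T ^^ i) x"] funpow_in[OF assms(2), of i] by auto
  then have "(\<Sum>i=m..<n. - F) \<le> (\<Sum>i=m..<n. f ((T ^^ i) x))"
    by (intro sum_mono)
  ultimately show ?thesis using assms(3) by (simp add: of_nat_diff)
qed

text \<open>Take the last level not exceeding \<open>n\<close> and the cells of its depth that meet
  the ball. Of the three \<open>\<gamma>\<close> lost, one pays for the number of cells, one for the
  oscillation within a cell, one for the times between that level and \<open>n\<close>.\<close>

lemma bowen_ball_cell_cover:
  assumes fin: "\<And>j. finite (\<pi> j ` X)"
    and card: "\<And>j x. real (card (\<pi> j ` bowen_ball X T (sparse_level q v j) x r)) \<le> exp (\<tau> * real (sparse_level q v j))"
    and osc: "\<And>k x y. x \<in> X \<Longrightarrow> y \<in> X \<Longrightarrow> \<pi> k x = \<pi> k y \<Longrightarrow>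
      birkhoff_sum T f (sparse_level q v k) x
        \<le> birkhoff_sum T f (sparse_level q v k) y + real (sparse_level q v k) * \<gamma>"
    and F: "\<And>x. x \<in> X \<Longrightarrow> \<bar>f x\<bar> \<le> F"
    and q: "0 < q" "q \<le> v" "F + \<bar>\<sigma>\<bar> \<le> real q * \<gamma>"
    and \<tau>: "0 \<le> \<tau>" "\<tau> * (2 * real q + 1) \<le> \<gamma>"
    and x: "x \<in> X" and n: "v \<le> n"
  shows "\<exists>R. R \<subseteq> cell_nodes X \<pi> \<and> bowen_ball X T n x r \<subseteq> \<Union>(snd ` R) \<and>
    emeasure (node_cost (cell_weight (sparse_level q v) \<sigma>)) R
      \<le> ennreal (exp (- (\<sigma> - 3 * \<gamma>) * real n + Sup (birkhoff_sum T f n ` bowen_ball X T n x r)))"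
proof -
  let ?\<nu> = "sparse_level q v"
  obtain k where k: "?\<nu> k \<le> n" "n < ?\<nu> (Suc k)"
    using exists_sparse_level[OF q(1,2) n] by blast
  define B where "B = bowen_ball X T n x r"
  have BX: "B \<subseteq> X" unfolding B_def by (rule bowen_ball_subset)
  define S where "S = Sup (birkhoff_sum T f n ` B)"
  define R where "R = Pair k ` (cell X \<pi> k ` B)"
  have F0: "0 \<le> F" using F[OF x] by linarith
  have \<gamma>: "0 \<le> \<gamma>"
    using q(1,3) F0 by (metis abs_ge_zero add_nonneg_nonneg of_nat_0_less_iff order_trans zero_le_mult_iff not_less)
  have finB: "finite (\<pi> j ` B)" for j
    using fin[of j] BX by (meson finite_subset image_mono)
  have cardB: "real (card (\<pi> j ` B)) \<le> exp (\<tau> * real (?\<nu> j))" if "j \<le> k" for j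
  proof -
    have "B \<subseteq> bowen_ball X T (?\<nu> j) x r"
      unfolding B_def using k(1) sparse_level_mono[OF that, of q v] by (intro bowen_ball_antimono) simp
    moreover have "finite (\<pi> j ` bowen_ball X T (?\<nu> j) x r)"
      using fin[of j] bowen_ball_subset by (meson finite_subset image_mono)
    ultimately have "card (\<pi> j ` B) \<le> card (\<pi> j ` bowen_ball X T (?\<nu> j) x r)"
      by (intro card_mono image_mono)
    then show ?thesis using card[of j x] by linarith
  qed
  have cells: "finite (cell X \<pi> k ` B)" "card (cell X \<pi> k ` B) \<le> (\<Prod>j\<le>k. card (\<pi> j ` B))"
    by (rule card_cells_le, rule finB)+
  have "real (card R) \<le> real (card (cell X \<pi> k ` B))"
    unfolding R_def using cells(1) by (simp add: card_image_le)
  also have "\<dots> \<le> (\<Prod>j\<le>k. real (card (\<pi> j ` B)))"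
    using cells(2) by (metis of_nat_le_iff of_nat_prod)
  also have "\<dots> \<le> (\<Prod>j\<le>k. exp (\<tau> * real (?\<nu> j)))"
    using cardB by (intro prod_mono) auto
  also have "\<dots> = exp (\<tau> * real (\<Sum>j\<le>k. ?\<nu> j))"
    by (simp add: exp_sum sum_distrib_left)
  \<comment> \<open>Geometric growth bounds the sum of all levels by \<open>2 * q + 1\<close> times
    the last one, and \<open>\<tau>\<close> is small enough to offset this factor.\<close>
  also have "\<dots> \<le> exp (\<gamma> * real n)"
  proof -
    have "(\<Sum>j\<le>k. ?\<nu> j) \<le> (2 * q + 1) * ?\<nu> k"
      using sum_sparse_level[OF q(1,2), of k] by (simp add: lessThan_Suc_atMost[symmetric])
    then have "real (\<Sum>j\<le>k. ?\<nu> j) \<le> real ((2 * q + 1) * ?\<nu> k)"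
      by (simp only: of_nat_le_iff)
    also have "\<dots> = (2 * real q + 1) * real (?\<nu> k)"
      by (simp only: of_nat_mult of_nat_add of_nat_numeral of_nat_1)
    finally have "real (\<Sum>j\<le>k. ?\<nu> j) \<le> (2 * real q + 1) * real (?\<nu> k)" .
    then have "\<tau> * real (\<Sum>j\<le>k. ?\<nu> j) \<le> \<tau> * (2 * real q + 1) * real (?\<nu> k)"
      using \<tau>(1) by (simp add: mult_left_mono mult.assoc)
    also have "\<dots> \<le> \<gamma> * real n"
      using \<tau> \<gamma> k(1) by (intro mult_mono) auto
    finally show ?thesis by simp
  qed
  finally have cardR: "real (card R) \<le> exp (\<gamma> * real n)" .
  have weight: "cell_weight ?\<nu> \<sigma> a \<le> ennreal (exp (- (\<sigma> - 2 * \<gamma>) * real n + S))" if "a \<in> R" for a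
  proof -
    obtain y where y: "y \<in> B" "a = (k, cell X \<pi> k y)" using \<open>a \<in> R\<close> by (auto simp: R_def)
    have yX: "y \<in> X" using y BX by auto
    \<comment> \<open>The cell may stick out of \<open>B\<close>, so its supremum is compared with
      \<open>S\<close> through the point \<open>y\<close> of \<open>B\<close>.\<close>
    have "Sup (birkhoff_sum T f (?\<nu> k) ` cell X \<pi> k y) \<le> birkhoff_sum T f (?\<nu> k) y + real (?\<nu> k) * \<gamma>"
      using cell_self[OF yX, of \<pi> k] yX by (intro cSUP_least osc) (auto simp: cell_def)
    also have "birkhoff_sum T f (?\<nu> k) y \<le> birkhoff_sum T f n y + (real n - real (?\<nu> k)) * F"
      by (rule birkhoff_sum_shorten[OF F yX k(1)])
    also have "birkhoff_sum T f n y \<le> S"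
      unfolding S_def by (rule cSUP_upper[OF y(1) bdd_above_birkhoff[OF BX]])
    finally have sup: "Sup (birkhoff_sum T f (?\<nu> k) ` cell X \<pi> k y)
        \<le> S + (real n - real (?\<nu> k)) * F + real (?\<nu> k) * \<gamma>" by simp
    define t where "t = real n - real (?\<nu> k)"
    have t: "0 \<le> t" using k(1) by (simp add: t_def)
    \<comment> \<open>Each of the \<open>t\<close> times cut off costs at most
      \<open>F + \<bar>\<sigma>\<bar>\<close>, and \<open>t\<close> is at most the fraction
      \<open>1/q\<close> of the level, so the choice of \<open>q\<close> bounds the total by
      \<open>\<gamma>\<close> times the level.\<close>
    have "n \<le> ?\<nu> k + ?\<nu> k div q" using k(2) by simp
    then have "t * real q \<le> real (?\<nu> k div q * q)"
      unfolding t_def of_nat_mult by (intro mult_right_mono) linarith+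
    also have "\<dots> \<le> real (?\<nu> k)"
      by (simp only: of_nat_le_iff div_times_less_eq_dividend)
    finally have tq: "t * real q \<le> real (?\<nu> k)" .
    have "- \<sigma> * real (?\<nu> k) = - \<sigma> * real n + \<sigma> * t" by (simp add: t_def algebra_simps)
    also have "\<dots> \<le> - \<sigma> * real n + \<bar>\<sigma>\<bar> * t" using t by (simp add: mult_right_mono)
    finally have "- \<sigma> * real (?\<nu> k) + Sup (birkhoff_sum T f (?\<nu> k) ` cell X \<pi> k y)
        \<le> - \<sigma> * real n + S + t * (F + \<bar>\<sigma>\<bar>) + real (?\<nu> k) * \<gamma>"
      using sup by (simp add: t_def algebra_simps)
    also have "t * (F + \<bar>\<sigma>\<bar>) \<le> t * (real q * \<gamma>)"
      using q(3) t by (rule mult_left_mono)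
    also have "\<dots> \<le> real (?\<nu> k) * \<gamma>"
      using mult_right_mono[OF tq \<gamma>] by (simp add: mult.assoc)
    also have "real (?\<nu> k) * \<gamma> \<le> real n * \<gamma>"
      using k(1) \<gamma> by (intro mult_right_mono) auto
    finally show ?thesis
      unfolding cell_weight_def y(2) by (intro ennreal_leI) (simp add: algebra_simps)
  qed
  have "emeasure (node_cost (cell_weight ?\<nu> \<sigma>)) R
      \<le> of_nat (card R) * ennreal (exp (- (\<sigma> - 2 * \<gamma>) * real n + S))"
    using cells(1) weight by (intro emeasure_node_cost_le) (auto simp: R_def)
  also have "\<dots> = ennreal (real (card R) * exp (- (\<sigma> - 2 * \<gamma>) * real n + S))"
    by (simp add: ennreal_mult ennreal_of_nat_eq_real_of_nat)
  also have "\<dots> \<le> ennreal (exp (\<gamma> * real n) * exp (- (\<sigma> - 2 * \<gamma>) * real n + S))"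
    using cardR by (intro ennreal_leI mult_right_mono) auto
  also have "\<dots> = ennreal (exp (- (\<sigma> - 3 * \<gamma>) * real n + S))"
    by (simp add: exp_add[symmetric] algebra_simps)
  finally have "emeasure (node_cost (cell_weight ?\<nu> \<sigma>)) R
      \<le> ennreal (exp (- (\<sigma> - 3 * \<gamma>) * real n + S))" .
  moreover have "R \<subseteq> cell_nodes X \<pi>" using BX by (auto simp: R_def cell_nodes_def)
  moreover have "B \<subseteq> \<Union>(snd ` R)" using BX cell_self[of _ X \<pi> k] by (force simp: R_def)
  ultimately show ?thesis unfolding S_def B_def by blast
qed

end

section \<open>Partitions for all large lengths\<close>

context compact_dynamics
begin

text \<open>Because the rate \<open>C\<close> does not depend on the scale, \<open>k\<close> can be
  fixed first, with \<open>C / k\<close> at most \<open>\<tau> / 2\<close>, and the scale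
  \<open>\<rho>\<close> afterwards. Doubling the rate \<open>C / k\<close> absorbs the factor linear
  in \<open>n\<close> in the number of colours.\<close>

lemma eventually_bowen_partition:
  assumes ent: "top_entropy X T < \<infinity>" and ne: "X \<noteq> {}" and "0 < \<Delta>" "0 < \<tau>"
  shows "\<exists>r. 0 < r \<and> r \<le> \<Delta> \<and> (\<forall>\<^sub>F n in sequentially. \<exists>\<pi> :: 'a \<Rightarrow> nat \<times> 'a. finite (\<pi> ` X) \<and>
    (\<forall>x\<in>X. \<forall>y\<in>X. \<pi> x = \<pi> y \<longrightarrow> dyn_dist T n x y < \<Delta>) \<and>
    (\<forall>x. real (card (\<pi> ` bowen_ball X T n x r)) \<le> exp (\<tau> * real n)))"
proof -
  obtain C where C: "0 < C"
    "\<And>e. 0 < e \<Longrightarrow> \<forall>\<^sub>F n in sequentially. real (max_separated X T n e) \<le> exp (C * real n)"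
    by (rule max_separated_exp_bound[OF ent ne]) blast
  define k where "k = Suc (nat \<lceil>2 * C / \<tau>\<rceil>)"
  have k: "0 < k" "2 * C / \<tau> \<le> real k" by (auto simp: k_def) linarith
  define a where "a = C / real k"
  have a: "0 < a" "2 * a \<le> \<tau>"
    using k C(1) \<open>0 < \<tau>\<close> by (auto simp: a_def field_simps)
  \<comment> \<open>With this value the diameter bound of \<open>bowen_partition\<close> reads
    \<open>\<Delta> / 2 + \<rho> / 2\<close>, which is below \<open>\<Delta>\<close>.\<close>
  define \<rho> where "\<rho> = \<Delta> / (4 * real k)"
  have \<rho>: "0 < \<rho>" using \<open>0 < \<Delta>\<close> k(1) by (simp add: \<rho>_def)
  have k\<rho>: "real k * \<rho> = \<Delta> / 4" using k(1) by (simp add: \<rho>_def)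
  have "1 * \<rho> \<le> real k * \<rho>" using k(1) \<rho> by (intro mult_right_mono) auto
  then have \<rho>\<Delta>: "\<rho> \<le> \<Delta> / 4" using k\<rho> by simp
  have "\<forall>\<^sub>F n in sequentially. \<exists>\<pi> :: 'a \<Rightarrow> nat \<times> 'a. finite (\<pi> ` X) \<and>
    (\<forall>x\<in>X. \<forall>y\<in>X. \<pi> x = \<pi> y \<longrightarrow> dyn_dist T n x y < \<Delta>) \<and>
    (\<forall>x. real (card (\<pi> ` bowen_ball X T n x (\<rho>/4))) \<le> exp (\<tau> * real n))"
  proof -
    have "\<forall>\<^sub>F n in sequentially. real (max_separated X T n (\<rho>/4)) \<le> exp (C * real n)"
      using \<rho> by (intro C(2)) simp
    then show ?thesis
      using exp_beats_linear_factor[OF a(1) C(1)]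
    proof eventually_elim
      case (elim n)
      define m where "m = nat \<lceil>exp (a * real n) * (C * real n + 1)\<rceil>"
      have m0: "exp (C * real n / real k) * (C * real n + 1) \<le> real m"
        unfolding m_def a_def by (simp add: of_nat_ceiling)
      have "0 \<le> exp (a * real n) * (C * real n + 1)" using C(1) by simp
      then have "real m \<le> exp (a * real n) * (C * real n + 1) + 1"
        unfolding m_def by linarith
      also have "\<dots> \<le> exp (2 * a * real n)" by (rule elim(2))
      also have "\<dots> \<le> exp (\<tau> * real n)" using a(2) by (simp add: mult_right_mono)
      finally have m1: "real m \<le> exp (\<tau> * real n)" .
      have c0: "0 \<le> C * real n" using C(1) by simp
      obtain \<pi> :: "'a \<Rightarrow> nat \<times> 'a" where "finite (\<pi> ` X)"
        and diam: "\<And>x y. x \<in> X \<Longrightarrow> y \<in> X \<Longrightarrow> \<pi> x = \<pi> y \<Longrightarrow> dyn_dist T n x y \<le> 2 * real k * \<rho> + \<rho> / 2"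
        and card: "\<And>x. card (\<pi> ` bowen_ball X T n x (\<rho>/4)) \<le> m"
        by (rule bowen_partition[OF k(1) \<rho> c0 elim(1) m0]) blast
      moreover have "2 * real k * \<rho> + \<rho> / 2 < \<Delta>"
        using k\<rho> \<rho>\<Delta> \<open>0 < \<Delta>\<close> by simp
      then have "dyn_dist T n x y < \<Delta>" if "x \<in> X" "y \<in> X" "\<pi> x = \<pi> y" for x y
        using diam[OF that] by simp
      moreover have "real (card (\<pi> ` bowen_ball X T n x (\<rho>/4))) \<le> exp (\<tau> * real n)" for x
        using card[of x] m1 by linarith
      ultimately show ?case by blast
    qed
  qed
  moreover have "0 < \<rho>/4" "\<rho>/4 \<le> \<Delta>" using \<rho> \<rho>\<Delta> by auto
  ultimately show ?thesis by blast
qed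

end

section \<open>Extraction of the compact subset\<close>

context compact_dynamics_potential
begin

text \<open>The value of \<open>c\<close> on the compact set is never estimated, and no continuity
  along decreasing sequences enters. Openness of Bowen balls lets a cover of \<open>K\<close> also
  cover some cylinder image, where \<open>c\<close> exceeds \<open>a\<close>.\<close>

lemma compact_subset_pressure_M:
  fixes c :: "'a set \<Rightarrow> ennreal"
  assumes Z: "Z \<subseteq> X" "analytic_set Z"
    and inc: "\<And>A. incseq A \<Longrightarrow> c (\<Union>n. A n) = (SUP n. c (A n))"
    and le: "\<And>A. A \<subseteq> X \<Longrightarrow> c A \<le> pressure_M X T f A s v r"
    and pos: "0 < c Z" and "0 < r"
  shows "\<exists>K\<subseteq>Z. compact K \<and> 0 < pressure_M X T f K s v r"
proof -
  obtain g :: "(nat \<Rightarrow> nat) \<Rightarrow> 'a" where g: "continuous_on UNIV g" "range g = Z"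
    using Z(2) by (auto simp: analytic_set_def)
  \<comment> \<open>The bound is fixed before any cover, so it survives the infimum over
    covers.\<close>
  obtain a where a: "0 < a" "a < c (range g)" using pos g(2) dense by blast
  obtain b where b: "\<And>i. a < c (g ` cylinder_below b i)"
    using exists_bounding_sequence[OF inc a(2)] by blast
  define K where "K = g ` {\<sigma>. \<forall>j. \<sigma> j \<le> b j}"
  have "compact K"
    unfolding K_def
    by (intro compact_continuous_image continuous_on_subset[OF g(1)] compact_box_below) auto
  moreover have "K \<subseteq> Z" using g(2) by (auto simp: K_def)
  moreover have "a \<le> pressure_M X T f K s v r"
  proof (rule pressure_M_greatest)
    fix I x k assume cov: "bowen_cover X T K v r I x k"
    let ?U = "\<Union>i\<in>I. bowen_ball X T (k i) (x i) r"
    have "openin (top_of_set X) ?U"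
      using openin_bowen_ball[OF \<open>0 < r\<close>] by (intro openin_Union) auto
    \<comment> \<open>The balls are open only relative to \<open>X\<close>. An ambient open set
      serves as well, since the cylinder images stay inside \<open>X\<close>.\<close>
    then obtain V where V: "open V" "?U = X \<inter> V" by (auto simp: openin_open)
    have "K \<subseteq> V" using cov V(2) unfolding bowen_cover_def by blast
    then obtain i where i: "g ` cylinder_below b i \<subseteq> V"
      using open_contains_cylinder_below[OF g(1) V(1)] unfolding K_def by blast
    have AX: "g ` cylinder_below b i \<subseteq> X" using g(2) Z(1) by blast
    then have "bowen_cover X T (g ` cylinder_below b i) v r I x k"
      using cov i V(2) unfolding bowen_cover_def by simp
    then have "pressure_M X T f (g ` cylinder_below b i) s v r \<le> (\<Sum>i. if i \<in> I then
      ennreal (exp (- s * real (k i) + Sup (birkhoff_sum T f (k i) ` bowen_ball X T (k i) (x i) r))) else 0)"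
      by (rule pressure_M_le)
    with le[OF AX] b[of i] show "a \<le> (\<Sum>i. if i \<in> I then
      ennreal (exp (- s * real (k i) + Sup (birkhoff_sum T f (k i) ` bowen_ball X T (k i) (x i) r))) else 0)"
      by order
  qed
  ultimately show ?thesis using a(1) by (meson less_le_trans)
qed

lemma compact_subset_pressure:
  assumes ent: "top_entropy X T < \<infinity>" and Z: "Z \<subseteq> X" "analytic_set Z"
    and s: "ereal s < bowen_pressure X T f Z"
  shows "\<exists>K\<subseteq>Z. compact K \<and> ereal s \<le> bowen_pressure X T f K"
proof -
  \<comment> \<open>Analytic sets are nonempty here, being images of all of Baire space.\<close>
  have ne: "X \<noteq> {}" using Z by (auto simp: analytic_set_def)
  obtain s' where s': "s < s'" "ereal s' < bowen_pressure X T f Z"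
    using ereal_dense2[OF s] by auto
  \<comment> \<open>Five losses: one from balls of radius \<open>\<Delta>\<close> to cells, three
    from cells to balls of radius \<open>r\<close>, one from radius \<open>r\<close> to the
    limit.\<close>
  define \<gamma> where "\<gamma> = (s' - s) / 5"
  have \<gamma>: "0 < \<gamma>" using s'(1) by (simp add: \<gamma>_def)
  obtain r0 where r0: "0 < r0" "\<And>n x y. x \<in> X \<Longrightarrow> y \<in> X \<Longrightarrow> dyn_dist T n x y < r0 \<Longrightarrow>
      birkhoff_sum T f n x \<le> birkhoff_sum T f n y + real n * \<gamma>"
    using birkhoff_oscillation[OF \<gamma>] by blast
  have "\<forall>\<^sub>F e in at_right 0. ereal s' < bowen_pressure_eps X T f Z e"
    using bowen_pressure_tendsto s'(2) by (rule order_tendstoD)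
  moreover have "\<forall>\<^sub>F e in at_right 0. e \<in> {0<..<r0}"
    using r0(1) by (rule eventually_at_right_real)
  ultimately have "\<forall>\<^sub>F e in at_right 0. ereal s' < bowen_pressure_eps X T f Z e \<and> e \<in> {0<..<r0}"
    by (rule eventually_conj)
  then obtain \<Delta> where \<Delta>: "ereal s' < bowen_pressure_eps X T f Z \<Delta>" "0 < \<Delta>" "\<Delta> < r0"
    using eventually_happens'[of "at_right (0::real)"] by fastforce
  obtain N where N: "0 < pressure_M X T f Z s' N \<Delta>" using pressure_M_pos[OF \<Delta>(1)] by blast
  have osc: "birkhoff_sum T f n x \<le> birkhoff_sum T f n y + real n * \<gamma>"
    if "x \<in> X" "y \<in> X" "dyn_dist T n x y < \<Delta>" for n x y
    using r0(2)[of x y n] that \<Delta>(3) by simp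
  obtain F where F: "\<And>x. x \<in> X \<Longrightarrow> \<bar>f x\<bar> \<le> F" using f_bounded by blast
  define \<sigma> where "\<sigma> = s' - \<gamma>"
  define q where "q = Suc (nat \<lceil>(F + \<bar>\<sigma>\<bar>) / \<gamma>\<rceil>)"
  have "(F + \<bar>\<sigma>\<bar>) / \<gamma> \<le> real q" unfolding q_def by linarith
  then have q: "0 < q" "F + \<bar>\<sigma>\<bar> \<le> real q * \<gamma>" using \<gamma> by (auto simp: q_def field_simps)
  define \<tau> where "\<tau> = \<gamma> / (2 * real q + 1)"
  have \<tau>: "0 < \<tau>" "\<tau> * (2 * real q + 1) \<le> \<gamma>" using \<gamma> by (auto simp: \<tau>_def add_pos_nonneg field_simps)
  obtain r where r: "0 < r" "r \<le> \<Delta>" and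
    ev: "\<forall>\<^sub>F n in sequentially. \<exists>\<pi> :: 'a \<Rightarrow> nat \<times> 'a. finite (\<pi> ` X) \<and>
      (\<forall>x\<in>X. \<forall>y\<in>X. \<pi> x = \<pi> y \<longrightarrow> dyn_dist T n x y < \<Delta>) \<and>
      (\<forall>x. real (card (\<pi> ` bowen_ball X T n x r)) \<le> exp (\<tau> * real n))"
    using eventually_bowen_partition[OF ent ne \<Delta>(2) \<tau>(1)] by blast
  obtain n0 where n0: "\<And>n. n0 \<le> n \<Longrightarrow> \<exists>\<pi> :: 'a \<Rightarrow> nat \<times> 'a. finite (\<pi> ` X) \<and>
      (\<forall>x\<in>X. \<forall>y\<in>X. \<pi> x = \<pi> y \<longrightarrow> dyn_dist T n x y < \<Delta>) \<and>
      (\<forall>x. real (card (\<pi> ` bowen_ball X T n x r)) \<le> exp (\<tau> * real n))"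
    using ev unfolding eventually_sequentially by blast
  \<comment> \<open>Beyond \<open>n0\<close> the partitions exist, beyond \<open>N\<close> the sum
    for \<open>Z\<close> is positive, and \<open>q\<close> makes the levels grow.\<close>
  define v where "v = max n0 (max N q)"
  define \<nu> where "\<nu> = sparse_level q v"
  have \<nu>: "n0 \<le> \<nu> k" "v \<le> \<nu> k" for k
    using sparse_level_ge[of v q k] by (auto simp: \<nu>_def v_def)
  have "\<exists>\<pi> :: nat \<Rightarrow> 'a \<Rightarrow> nat \<times> 'a. \<forall>k. finite (\<pi> k ` X) \<and>
      (\<forall>x\<in>X. \<forall>y\<in>X. \<pi> k x = \<pi> k y \<longrightarrow> dyn_dist T (\<nu> k) x y < \<Delta>) \<and>
      (\<forall>x. real (card (\<pi> k ` bowen_ball X T (\<nu> k) x r)) \<le> exp (\<tau> * real (\<nu> k)))"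
    by (rule choice) (use n0[OF \<nu>(1)] in blast)
  then obtain \<pi> :: "nat \<Rightarrow> 'a \<Rightarrow> nat \<times> 'a" where fin: "\<And>k. finite (\<pi> k ` X)"
    and diam: "\<And>k x y. x \<in> X \<Longrightarrow> y \<in> X \<Longrightarrow> \<pi> k x = \<pi> k y \<Longrightarrow> dyn_dist T (\<nu> k) x y < \<Delta>"
    and card: "\<And>k x. real (card (\<pi> k ` bowen_ball X T (\<nu> k) x r)) \<le> exp (\<tau> * real (\<nu> k))"
    by blast
  let ?c = "node_content (cell_nodes X \<pi>) (cell_weight \<nu> \<sigma>)"
  have "0 < pressure_M X T f Z s' N \<Delta>" by (rule N)
  also have "\<dots> \<le> pressure_M X T f Z (\<sigma> + \<gamma>) v \<Delta>"
    using pressure_M_mono_level[of N v X T f Z s' \<Delta>] by (simp add: v_def \<sigma>_def)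
  also have "\<dots> \<le> ?c Z"
    by (rule pressure_M_le_node_content[OF fin diam osc \<Delta>(2) \<nu>(2)])
  finally have pos: "0 < ?c Z" .
  have qv: "q \<le> v" by (simp add: v_def)
  have le: "?c A \<le> pressure_M X T f A (\<sigma> - 3 * \<gamma>) v r" for A
  proof (rule node_content_le_pressure_M)
    fix x n assume x: "x \<in> X" and n: "v \<le> n"
    show "\<exists>R. R \<subseteq> cell_nodes X \<pi> \<and> bowen_ball X T n x r \<subseteq> \<Union>(snd ` R) \<and>
      emeasure (node_cost (cell_weight \<nu> \<sigma>)) R
        \<le> ennreal (exp (- (\<sigma> - 3 * \<gamma>) * real n + Sup (birkhoff_sum T f n ` bowen_ball X T n x r)))"
      unfolding \<nu>_def
      by (rule bowen_ball_cell_cover[OF fin card[unfolded \<nu>_def] osc[OF _ _ diam[unfolded \<nu>_def]]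
            F q(1) qv q(2) less_imp_le[OF \<tau>(1)] \<tau>(2) x n])
  qed
  obtain K where K: "K \<subseteq> Z" "compact K" "0 < pressure_M X T f K (\<sigma> - 3 * \<gamma>) v r"
    using compact_subset_pressure_M[of Z ?c, OF Z node_content_UN_incseq[OF laminar_cell_nodes] le pos r(1)]
    by blast
  have "\<sigma> - 3 * \<gamma> = s + \<gamma>" by (simp add: \<sigma>_def \<gamma>_def field_simps)
  from K(3)[unfolded this] have "ereal s \<le> bowen_pressure X T f K"
    using r \<Delta>(3) by (intro bowen_pressure_eps_le[of r \<gamma> K s v] r0(2)) simp_all
  with K show ?thesis by blast
qed

end

theorem theoremA:
  fixes X :: "'a::metric_space set" and T :: "'a \<Rightarrow> 'a" and f :: "'a \<Rightarrow> real" and Z :: "'a set"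
  assumes "compact X"
    and "T ` X \<subseteq> X" and "continuous_on X T"
    and "top_entropy X T < \<infinity>"
    and "continuous_on X f"
    and "Z \<subseteq> X" and "analytic_set Z"
  shows "bowen_pressure X T f Z = Sup {bowen_pressure X T f K | K. K \<subseteq> Z \<and> compact K}"
proof (rule antisym)
  interpret compact_dynamics_potential X T f
    using assms(1,2,3,5) by unfold_locales
  show "bowen_pressure X T f Z \<le> Sup {bowen_pressure X T f K | K. K \<subseteq> Z \<and> compact K}"
  proof (rule ccontr)
    assume "\<not> ?thesis"
    then obtain s where s: "Sup {bowen_pressure X T f K | K. K \<subseteq> Z \<and> compact K} < ereal s"
      "ereal s < bowen_pressure X T f Z"
      using ereal_dense2 by (meson not_le)
    obtain K where K: "K \<subseteq> Z" "compact K" "ereal s \<le> bowen_pressure X T f K"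
      using compact_subset_pressure[OF assms(4,6,7) s(2)] by blast
    then have "bowen_pressure X T f K \<le> Sup {bowen_pressure X T f K | K. K \<subseteq> Z \<and> compact K}"
      by (intro Sup_upper) blast
    with K(3) s(1) show False by order
  qed
  show "Sup {bowen_pressure X T f K | K. K \<subseteq> Z \<and> compact K} \<le> bowen_pressure X T f Z"
    by (rule Sup_least) (auto intro: bowen_pressure_mono)
qed

end
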